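(* Let $G$ be a finite group, let $\rho:G\to\mathrm{GL}(V)$ be a finite-dimensional complex representation, and let $N=\ker\rho$. Suppose that $G=N\times H$ (internal direct product) for a complementary normal subgroup $H$ of $G$. Then all the connected components of the McKay quiver $\Gamma_\rho(G)$ are isomorphic as quivers.
   Context: Let $\sigma_1,\dots,\sigma_r$ be a complete list of the irreducible complex representations of $G$ up to isomorphism, with $\sigma_1$ trivial. The McKay matrix $A_\rho(G)=(a_{ij})_{i,j=1}^r$ has as entries the non-negative integers determined by $\rho\otimes\sigma_i\cong\bigoplus_{j=1}^r\sigma_j^{\oplus a_{ij}}$. The McKay quiver $\Gamma_\rho(G)$ is the quiver with vertices $v_1,\dots,v_r$ and $a_{ij}$ directed edges from $v_i$ to $v_j$. A connected component of $\Gamma_\rho(G)$ means a strongly connected component (maximal subquiver in which there is a directed path, possibly of length $0$, from any vertex to any other) or equivalently a weakly connected component (connected component after forgetting edge directions); for McKay quivers these two notions coincide. *)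

theory Defs
  imports
    "HOL-Algebra.Coset"
    "Jordan_Normal_Form.VS_Connect"
    "Graph_Theory.Graph_Theory"
begin

section \<open>Complex matrix representations\<close>

text \<open>
  A finite-dimensional complex representation is given in coordinates, i.e.\ on the space
  \<open>carrier_vec n\<close> for a natural number \<open>n\<close> (\<open>n = 0\<close> is allowed). Only the values of a
  representation on \<open>carrier G\<close> matter.
\<close>

definition GL :: "nat \<Rightarrow> complex mat monoid" where
  "GL n = units_of (ring_mat TYPE(complex) n ())"

definition representation ::
    "('g, 'm) monoid_scheme \<Rightarrow> nat \<Rightarrow> ('g \<Rightarrow> complex mat) \<Rightarrow> bool" where
  "representation G n \<rho> \<longleftrightarrow> \<rho> \<in> hom G (GL n)"

definition irreducible_representation ::
    "('g, 'm) monoid_scheme \<Rightarrow> nat \<Rightarrow> ('g \<Rightarrow> complex mat) \<Rightarrow> bool" where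
  "irreducible_representation G n \<sigma> \<longleftrightarrow>
     representation G n \<sigma> \<and> n \<noteq> 0 \<and>
     (\<forall>W. VectorSpace.subspace class_ring W (module_vec TYPE(complex) n) \<longrightarrow>
        (\<forall>g\<in>carrier G. \<forall>w\<in>W. \<sigma> g *\<^sub>v w \<in> W) \<longrightarrow>
        W = {0\<^sub>v n} \<or> W = carrier_vec n)"

definition rep_iso ::
    "('g, 'm) monoid_scheme \<Rightarrow> ('g \<Rightarrow> complex mat) \<Rightarrow> ('g \<Rightarrow> complex mat) \<Rightarrow> bool" where
  "rep_iso G \<rho> \<sigma> \<longleftrightarrow>
     (\<exists>n. representation G n \<rho> \<and> representation G n \<sigma> \<and>
        (\<exists>P\<in>carrier (GL n). \<forall>g\<in>carrier G. P * \<rho> g = \<sigma> g * P))"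

definition trivial_rep :: "'g \<Rightarrow> complex mat" where
  "trivial_rep = (\<lambda>g. 1\<^sub>m 1)"

text \<open>Kronecker product: the matrix of a tensor product of linear maps with respect to the
  lexicographically ordered basis \<open>e\<^sub>i \<otimes> f\<^sub>j\<close>.\<close>

definition kronecker :: "complex mat \<Rightarrow> complex mat \<Rightarrow> complex mat" where
  "kronecker A B =
     mat (dim_row A * dim_row B) (dim_col A * dim_col B)
       (\<lambda>(i, j). A $$ (i div dim_row B, j div dim_col B) * B $$ (i mod dim_row B, j mod dim_col B))"

definition tensor_rep ::
    "('g \<Rightarrow> complex mat) \<Rightarrow> ('g \<Rightarrow> complex mat) \<Rightarrow> 'g \<Rightarrow> complex mat" where
  "tensor_rep \<rho> \<sigma> = (\<lambda>g. kronecker (\<rho> g) (\<sigma> g))"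

text \<open>The empty direct sum is the zero-dimensional representation.\<close>

definition direct_sum_rep :: "('g \<Rightarrow> complex mat) list \<Rightarrow> 'g \<Rightarrow> complex mat" where
  "direct_sum_rep \<sigma>s = (\<lambda>g. diag_block_mat (map (\<lambda>\<sigma>. \<sigma> g) \<sigma>s))"

definition complete_irreps ::
    "('g, 'm) monoid_scheme \<Rightarrow> ('g \<Rightarrow> complex mat) list \<Rightarrow> bool" where
  "complete_irreps G \<sigma>s \<longleftrightarrow>
     (\<forall>\<sigma>\<in>set \<sigma>s. \<exists>n. irreducible_representation G n \<sigma>) \<and>
     (\<forall>i<length \<sigma>s. \<forall>j<length \<sigma>s. i \<noteq> j \<longrightarrow> \<not> rep_iso G (\<sigma>s ! i) (\<sigma>s ! j)) \<and>
     (\<forall>n \<tau>. irreducible_representation G n \<tau> \<longrightarrow> (\<exists>\<sigma>\<in>set \<sigma>s. rep_iso G \<tau> \<sigma>)) \<and>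
     \<sigma>s \<noteq> [] \<and> rep_iso G (hd \<sigma>s) trivial_rep"

section \<open>The McKay quiver\<close>

text \<open>Indices are shifted: \<open>\<sigma>\<^sub>1, \<dots>, \<sigma>\<^sub>r\<close> are the list entries \<open>0, \<dots>, r - 1\<close>.\<close>

definition mckay_matrix ::
    "('g, 'm) monoid_scheme \<Rightarrow> ('g \<Rightarrow> complex mat) \<Rightarrow> ('g \<Rightarrow> complex mat) list \<Rightarrow> nat mat" where
  "mckay_matrix G \<rho> \<sigma>s =
     (THE A. A \<in> carrier_mat (length \<sigma>s) (length \<sigma>s) \<and>
        (\<forall>i<length \<sigma>s.
           rep_iso G (tensor_rep \<rho> (\<sigma>s ! i))
             (direct_sum_rep
               (concat (map (\<lambda>j. replicate (A $$ (i, j)) (\<sigma>s ! j)) [0..<length \<sigma>s])))))"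

text \<open>A quiver is a \<^typ>\<open>('a, 'b) pre_digraph\<close> (which allows loops and parallel arcs);
  the arc \<open>(i, j, k)\<close> is the \<open>k\<close>-th of the \<open>a\<^sub>i\<^sub>j\<close> arrows from vertex \<open>i\<close> to vertex \<open>j\<close>.\<close>

definition mckay_quiver ::
    "('g, 'm) monoid_scheme \<Rightarrow> ('g \<Rightarrow> complex mat) \<Rightarrow> ('g \<Rightarrow> complex mat) list \<Rightarrow>
     (nat, nat \<times> nat \<times> nat) pre_digraph" where
  "mckay_quiver G \<rho> \<sigma>s =
     \<lparr> verts = {..<length \<sigma>s},
       arcs = {(i, j, k). i < length \<sigma>s \<and> j < length \<sigma>s \<and> k < mckay_matrix G \<rho> \<sigma>s $$ (i, j)},
       tail = (\<lambda>(i, j, k). i),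
       head = (\<lambda>(i, j, k). j) \<rparr>"

section \<open>Internal direct products\<close>

definition internal_direct_product ::
    "('g, 'm) monoid_scheme \<Rightarrow> 'g set \<Rightarrow> 'g set \<Rightarrow> bool" where
  "internal_direct_product G N H \<longleftrightarrow>
     N \<lhd> G \<and> H \<lhd> G \<and> N \<inter> H = {\<one>\<^bsub>G\<^esub>} \<and> N <#>\<^bsub>G\<^esub> H = carrier G"

end

theory Submission
  imports "Jordan_Normal_Form.Spectral_Radius" Defs
begin

text \<open>
  Write \<open>N\<close> for the kernel of \<open>\<rho>\<close>, so that \<open>G = N \<times> H\<close>. Every irreducible representation of \<open>G\<close> is
  \<open>\<alpha> \<otimes> \<beta>\<close> for unique irreducible \<open>\<alpha>\<close>, \<open>\<beta>\<close> that are trivial on \<open>H\<close> and on \<open>N\<close>, respectively. Since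
  the character of \<open>\<rho>\<close> depends on the \<open>H\<close>-component only, the multiplicity of \<open>\<alpha>' \<otimes> \<beta>'\<close> in
  \<open>\<rho> \<otimes> \<alpha> \<otimes> \<beta>\<close> is zero unless \<open>\<alpha> = \<alpha>'\<close>, in which case it is the multiplicity of \<open>\<beta>'\<close> in
  \<open>\<rho> \<otimes> \<beta>\<close>. So the quiver is a disjoint union of copies, indexed by \<open>\<alpha>\<close>, of one quiver on the \<open>\<beta>\<close>'s, and
  it remains to see that each copy is strongly connected: as \<open>\<rho>\<close> is faithful on \<open>H\<close>, polynomials
  in its matrix entries give all functions on \<open>G / N\<close>.

  The whole argument takes place inside \<open>G\<close>, and characters are paired by
  \<open>\<Sum>\<^sub>g \<phi>(g) \<psi>(g\<^sup>-\<^sup>1)\<close>, which makes unitarity and complex conjugation unnecessary.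
\<close>

section \<open>Linear algebra\<close>

text \<open>The vertices are positions in an arbitrary list \<open>\<sigma>s\<close>, so both
  factors of an irreducible must be located in that same list: \<open>IN\<close> and
  \<open>IH\<close> hold the positions of the irreducibles trivial on \<open>H\<close> and on
  \<open>N\<close>, and \<open>prod_index p q\<close> is a position whose character is the product
  of \<open>\<chi> p\<close> and \<open>\<chi> q\<close>. Such a position exists because the squares
  of the multiplicities in the tensor product sum to 1. That every position arises is not shown by
  counting dimensions: the coefficients of a missing irreducible would be orthogonal to a span that
  contains them. The same orthogonality gives connectedness. If \<open>S\<close> is closed under
  outgoing arrows, the span of the coefficients of its members is stable under multiplication by
  entries of \<open>\<rho>\<close>, hence under restriction to the kernel. There the characters at
  \<open>prod_index p q\<close> and \<open>prod_index p q'\<close> are nonzero multiples of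
  \<open>\<chi> p\<close>, whose pairing with itself over the kernel is nonzero, so \<open>S\<close>
  cannot contain only the former. Since only outgoing arrows matter, \<open>S\<close> may be the set
  of vertices reachable from a given one, which yields strong connectedness at once.\<close>

lemma maximal_lin_indpt_subset:
  fixes W :: "'a :: field vec set"
  assumes "W \<subseteq> carrier_vec n"
    and "B \<subseteq> W" "\<not> LinearCombinations.module.lin_dep class_ring (module_vec TYPE('a) n) B"
  obtains A where "B \<subseteq> A" "A \<subseteq> W" "finite A" "\<not> LinearCombinations.module.lin_dep class_ring (module_vec TYPE('a) n) A"
    "W \<subseteq> LinearCombinations.module.span class_ring (module_vec TYPE('a) n) A"
proof -
  interpret vec_space "TYPE('a)" n .
  let ?P = "\<lambda>A. B \<subseteq> A \<and> A \<subseteq> W \<and> lin_indpt A"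
  have "\<exists>A. finite A \<and> maximal A ?P"
    by (rule maximal_exists[of _ dim B])
      (use assms li_le_dim in auto)
  then obtain A where A: "finite A" "maximal A ?P" by blast
  hence PA: "?P A" and max: "\<And>C. A \<subseteq> C \<Longrightarrow> ?P C \<Longrightarrow> C = A" unfolding maximal_def by blast+
  have Ac: "A \<subseteq> carrier_vec n" using PA assms by blast
  have "W \<subseteq> span A"
  proof
    fix w assume w: "w \<in> W"
    show "w \<in> span A"
    proof (cases "w \<in> A")
      case True
      then show ?thesis using Ac by (meson in_own_span subsetD)
    next
      case False
      have "lin_dep (A \<union> {w})"
        using max[of "A \<union> {w}"] PA w False by auto
      then show ?thesis using lin_dep_iff_in_span[of A w] Ac PA w assms(1) False by auto
    qed
  qed
  with that PA A show thesis by blast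
qed

text \<open>A basis of \<open>W\<close> is extended to one of the whole space. The columns of
  \<open>P\<close> are this basis with the vectors of \<open>W\<close> in front, and
  \<open>Q\<close> computes coordinates. The purpose is to bring a representation with an invariant
  subspace into block triangular form.\<close>

lemma adapted_basis:
  fixes W :: "'a :: field vec set"
  assumes W: "VectorSpace.subspace class_ring W (module_vec TYPE('a) n)"
    and W0: "W \<noteq> {0\<^sub>v n}" and W1: "W \<noteq> carrier_vec n"
  obtains k P Q where "0 < k" "k < n" "P \<in> carrier_mat n n" "Q \<in> carrier_mat n n"
    "P * Q = 1\<^sub>m n" "Q * P = 1\<^sub>m n" "\<And>j. j < k \<Longrightarrow> col P j \<in> W"
    "\<And>w i. w \<in> W \<Longrightarrow> k \<le> i \<Longrightarrow> i < n \<Longrightarrow> (Q *\<^sub>v w) $ i = 0"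
proof -
  interpret vec_space "TYPE('a)" n .
  have sub: "submodule class_ring W V" using W unfolding VectorSpace.subspace_def by auto
  have Wc: "W \<subseteq> carrier_vec n" using submodule.subset[OF sub] by simp
  have W_zero: "0\<^sub>v n \<in> W" using submodule.zero_closed[OF sub] by simp
  have "lin_indpt {}" by (simp add: lin_dep_def)
  from maximal_lin_indpt_subset[OF Wc _ this] obtain A where
    A: "A \<subseteq> W" "finite A" "lin_indpt A" "W \<subseteq> span A" by auto
  have Ac: "A \<subseteq> carrier_vec n" using A Wc by blast
  from maximal_lin_indpt_subset[OF subset_refl this A(3)] obtain B where
    B: "A \<subseteq> B" "B \<subseteq> carrier_vec n" "finite B" "lin_indpt B" "carrier_vec n \<subseteq> span B" by blast
  have spA: "span A = W" using A sub span_is_subset[of A W] by auto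
  have cA: "card A \<le> n" using li_le_dim(2)[OF fin_dim Ac A(3)] dim_is_n by simp
  have k0: "card A > 0"
  proof (rule ccontr)
    assume "\<not> card A > 0"
    hence "A = {}" using A by simp
    then show False using spA W0 span_empty by simp
  qed
  have kn: "card A < n"
  proof (rule ccontr)
    assume "\<not> card A < n"
    hence "basis A" using dim_li_is_basis[OF fin_dim A(2) Ac A(3)] dim_is_n by auto
    then show False using spA W1 unfolding basis_def by auto
  qed
  have bB: "basis B" using B span_is_subset2[of B] unfolding basis_def by auto
  have cB: "card B = n" using dim_basis[OF B(3) bB] dim_is_n by simp
  obtain as where as: "set as = A" "distinct as" using finite_distinct_list[OF A(2)] by blast
  obtain bs where bs: "set bs = B - A" "distinct bs" using finite_distinct_list[of "B - A"] B by blast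
  define vs where "vs = as @ bs"
  have vs: "set vs = B" "distinct vs" using as bs B by (auto simp: vs_def)
  have len: "length vs = n" using vs cB distinct_card by metis
  have lena: "length as = card A" using as distinct_card by metis
  define P where "P = mat_of_cols n vs"
  have P: "P \<in> carrier_mat n n" unfolding P_def using len by auto
  \<comment> \<open>Spanning makes \<open>P\<close> surjective; preimages of the unit vectors form
    the columns of a right inverse \<open>Q\<close>, which is two-sided because \<open>P\<close> is
    square.\<close>
  have "\<exists>y. y \<in> carrier_vec n \<and> P *\<^sub>v y = v" if v: "v \<in> carrier_vec n" for v
  proof -
    have "v \<in> span_list vs" using v B vs span_list_as_span[of vs] by auto
    then obtain c where "v = lincomb_list c vs" unfolding span_list_def by auto
    moreover have "\<forall>w\<in>set vs. dim_vec w = n" using B(2) vs(1) carrier_vecD by blast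
    ultimately have "v = P *\<^sub>v vec n c"
      using lincomb_list_as_mat_mult[of vs c] len unfolding P_def by simp
    then show ?thesis by (intro exI[of _ "vec n c"]) auto
  qed
  then obtain Y where Y: "\<And>v. v \<in> carrier_vec n \<Longrightarrow> Y v \<in> carrier_vec n \<and> P *\<^sub>v Y v = v" by metis
  define Q where "Q = mat_of_cols n (map (\<lambda>i. Y (unit_vec n i)) [0..<n])"
  have Q: "Q \<in> carrier_mat n n" unfolding Q_def by auto
  have PQ: "P * Q = 1\<^sub>m n"
  proof (rule mat_col_eqI)
    fix i assume "i < dim_col (1\<^sub>m n :: 'a mat)"
    hence i: "i < n" by simp
    have "col Q i = Y (unit_vec n i)"
      unfolding Q_def using i Y[of "unit_vec n i"] by (subst col_mat_of_cols) simp_all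
    then show "col (P * Q) i = col (1\<^sub>m n) i" using Y[of "unit_vec n i"] i
      unfolding col_mult2[OF P Q i] by simp
  qed (use P Q in auto)
  have QP: "Q * P = 1\<^sub>m n" using mat_mult_left_right_inverse[OF P Q PQ] .
  show thesis
  proof (rule that[OF k0 kn P Q PQ QP])
    fix j assume j: "j < card A"
    have "as ! j \<in> A" using j lena as(1) nth_mem[of j as] by simp
    moreover have jn: "j < length vs" using j kn len by simp
    have "vs ! j \<in> carrier_vec n" using nth_mem[OF jn] vs(1) B(2) by blast
    hence "col P j = vs ! j" unfolding P_def by (rule col_mat_of_cols[OF jn])
    moreover have "vs ! j = as ! j" using j lena by (simp add: vs_def nth_append)
    ultimately show "col P j \<in> W" using A(1) by auto
  next
    fix w i assume w: "w \<in> W" and i: "card A \<le> i" "i < n"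
    have "w \<in> span_list as" using w spA as(1) Ac span_list_as_span[of as] by simp
    then obtain c where c: "w = lincomb_list c as" unfolding span_list_def by auto
    \<comment> \<open>The coordinates of \<open>w\<close> in the basis of \<open>W\<close>, padded
      with zeros. As \<open>Q\<close> undoes \<open>P\<close>, this vector is the image of
      \<open>w\<close> under \<open>Q\<close>.\<close>
    let ?y = "vec n (\<lambda>i. if i < card A then c i else 0)"
    have "w = mat_of_cols n as *\<^sub>v vec (card A) c"
      unfolding c lena[symmetric] using as(1) Ac
      by (intro lincomb_list_as_mat_mult) (use carrier_vecD in blast)
    also have "\<dots> = P *\<^sub>v ?y"
    proof (rule eq_vecI)
      fix r assume "r < dim_vec (P *\<^sub>v ?y)"
      hence r: "r < n" using P by simp
      have "(P *\<^sub>v ?y) $ r = (\<Sum>i<n. P $$ (r, i) * (if i < card A then c i else 0))"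
        using P r by (simp add: scalar_prod_def lessThan_atLeast0)
      also have "\<dots> = (\<Sum>i<card A. P $$ (r, i) * c i)"
        by (rule sum.mono_neutral_cong_right) (use cA in auto)
      also have "\<dots> = (\<Sum>i<card A. (as ! i) $ r * c i)"
      proof (rule sum.cong)
        fix i assume "i \<in> {..<card A}"
        hence i: "i < card A" by simp
        hence "vs ! i = as ! i" using lena by (simp add: vs_def nth_append)
        moreover have "P $$ (r, i) = (vs ! i) $ r"
          using r kn len i unfolding P_def by (subst mat_of_cols_index) auto
        ultimately show "P $$ (r, i) * c i = (as ! i) $ r * c i" by simp
      qed simp
      also have "\<dots> = (mat_of_cols n as *\<^sub>v vec (card A) c) $ r"
        using r by (simp add: scalar_prod_def lessThan_atLeast0 mat_of_cols_index lena)
      finally show "(mat_of_cols n as *\<^sub>v vec (card A) c) $ r = (P *\<^sub>v ?y) $ r" by simp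
    qed (use P in auto)
    finally have "Q *\<^sub>v w = Q * P *\<^sub>v ?y" using assoc_mult_mat_vec[OF Q P, of ?y] by simp
    then show "(Q *\<^sub>v w) $ i = 0" using QP i by simp
  qed
qed

section \<open>Traces and Kronecker products\<close>

definition mat_trace :: "'a :: comm_ring_1 mat \<Rightarrow> 'a" where
  "mat_trace A = (\<Sum>i<dim_row A. A $$ (i, i))"

lemma mat_trace_mult:
  assumes "A \<in> carrier_mat n m" "B \<in> carrier_mat m n"
  shows "mat_trace (A * B) = (\<Sum>i<n. \<Sum>j<m. A $$ (i, j) * B $$ (j, i))"
  unfolding mat_trace_def
  using assms by (auto simp: scalar_prod_def lessThan_atLeast0 intro!: sum.cong)

lemma mat_trace_comm:
  assumes "A \<in> carrier_mat n m" "B \<in> carrier_mat m n"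
  shows "mat_trace (A * B) = mat_trace (B * A)"
  unfolding mat_trace_mult[OF assms] mat_trace_mult[OF assms(2,1)]
  by (subst sum.swap) (simp add: mult.commute)

lemma mat_trace_one [simp]: "mat_trace (1\<^sub>m n) = of_nat n"
  by (simp add: mat_trace_def)

lemma mat_trace_four_block:
  assumes "A \<in> carrier_mat n n" "D \<in> carrier_mat m m"
  shows "mat_trace (four_block_mat A B C D) = mat_trace A + mat_trace D"
proof -
  have "(\<Sum>i<n + m. f i) = (\<Sum>i<n. f i) + (\<Sum>i<m. f (n + i))" for f :: "nat \<Rightarrow> 'a"
    by (induction m) (simp_all add: add.assoc)
  from this[of "\<lambda>i. four_block_mat A B C D $$ (i, i)"] show ?thesis
    using assms unfolding mat_trace_def by auto
qed

text \<open>In the lexicographic order of a tensor basis the pair \<open>(i, j)\<close> has position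
  \<open>i * m + j\<close>, so \<open>div\<close> and \<open>mod\<close> recover the pair.\<close>

lemma sum_lessThan_div_mod:
  fixes f :: "nat \<Rightarrow> nat \<Rightarrow> 'a :: comm_monoid_add"
  assumes "0 < m"
  shows "(\<Sum>k<n * m. f (k div m) (k mod m)) = (\<Sum>i<n. \<Sum>j<m. f i j)"
proof -
  have "(\<Sum>k<n * m. f (k div m) (k mod m)) = (\<Sum>p\<in>{..<n} \<times> {..<m}. f (fst p) (snd p))"
  proof (rule sum.reindex_bij_witness[of _ "\<lambda>p. fst p * m + snd p" "\<lambda>k. (k div m, k mod m)"])
    fix p assume p: "p \<in> {..<n} \<times> {..<m}"
    have "fst p * m + snd p < Suc (fst p) * m" using p by auto
    also have "\<dots> \<le> n * m" using p by (intro mult_right_mono) auto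
    finally show "fst p * m + snd p \<in> {..<n * m}" by simp
  qed (use assms in \<open>auto simp: less_mult_imp_div_less\<close>)
  also have "\<dots> = (\<Sum>i<n. \<Sum>j<m. f i j)" by (simp add: sum.cartesian_product case_prod_beta)
  finally show ?thesis .
qed

lemma kronecker_carrier [simp]:
  "A \<in> carrier_mat a b \<Longrightarrow> B \<in> carrier_mat c d \<Longrightarrow> kronecker A B \<in> carrier_mat (a * c) (b * d)"
  by (auto simp: kronecker_def)

lemma index_kronecker:
  assumes "A \<in> carrier_mat a b" "B \<in> carrier_mat c d" "i < a" "j < b" "k < c" "l < d"
  shows "i * c + k < a * c" "j * d + l < b * d"
    and "kronecker A B $$ (i * c + k, j * d + l) = A $$ (i, j) * B $$ (k, l)"
proof -
  have *: "i * c + k < a * c" if "i < a" "k < c" for i k a c :: nat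
  proof -
    have "i * c + k < Suc i * c" using that by simp
    also have "\<dots> \<le> a * c" using that by (intro mult_right_mono) auto
    finally show ?thesis .
  qed
  show 1: "i * c + k < a * c" "j * d + l < b * d" using * assms by auto
  show "kronecker A B $$ (i * c + k, j * d + l) = A $$ (i, j) * B $$ (k, l)"
    using assms 1 by (auto simp: kronecker_def)
qed

text \<open>The mixed-product rule, which makes \<open>tensor_rep\<close> multiplicative.\<close>

lemma kronecker_mult:
  assumes A: "A \<in> carrier_mat a b" "C \<in> carrier_mat b e"
    and B: "B \<in> carrier_mat c d" "D \<in> carrier_mat d f"
  shows "kronecker (A * C) (B * D) = kronecker A B * kronecker C D"
proof (rule eq_matI)
  fix i j assume "i < dim_row (kronecker A B * kronecker C D)" "j < dim_col (kronecker A B * kronecker C D)"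
  hence i: "i < a * c" and j: "j < e * f" using assms by (auto simp: kronecker_def)
  have c0: "0 < c" "0 < f" using i j by (auto intro: gr0I)
  have i': "i div c < a" "i mod c < c" and j': "j div f < e" "j mod f < f"
    using i j c0 by (auto simp: less_mult_imp_div_less)
  have "kronecker (A * C) (B * D) $$ (i, j) = (A * C) $$ (i div c, j div f) * (B * D) $$ (i mod c, j mod f)"
    using assms i j by (auto simp: kronecker_def)
  also have "\<dots> = (\<Sum>k<b. A $$ (i div c, k) * C $$ (k, j div f)) *
      (\<Sum>l<d. B $$ (i mod c, l) * D $$ (l, j mod f))"
    using assms i' j' by (simp add: scalar_prod_def lessThan_atLeast0)
  also have "\<dots> = (\<Sum>k<b. \<Sum>l<d. A $$ (i div c, k) * B $$ (i mod c, l) *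
      (C $$ (k, j div f) * D $$ (l, j mod f)))"
    by (simp add: sum_product mult_ac)
  also have "\<dots> = (\<Sum>m<b * d. A $$ (i div c, m div d) * B $$ (i mod c, m mod d) *
      (C $$ (m div d, j div f) * D $$ (m mod d, j mod f)))"
  proof (cases "d = 0")
    case False
    then show ?thesis by (subst sum_lessThan_div_mod) auto
  qed simp
  also have "\<dots> = (\<Sum>m<b * d. kronecker A B $$ (i, m) * kronecker C D $$ (m, j))"
    using assms i j by (intro sum.cong) (auto simp: kronecker_def)
  also have "\<dots> = (kronecker A B * kronecker C D) $$ (i, j)"
    using assms i j by (simp add: scalar_prod_def lessThan_atLeast0 kronecker_def)
  finally show "kronecker (A * C) (B * D) $$ (i, j) = (kronecker A B * kronecker C D) $$ (i, j)" .
qed (use assms in \<open>auto simp: kronecker_def\<close>)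

lemma kronecker_one: "kronecker (1\<^sub>m n) (1\<^sub>m m) = 1\<^sub>m (n * m)"
proof (rule eq_matI)
  fix i j assume "i < dim_row (1\<^sub>m (n * m) :: complex mat)" "j < dim_col (1\<^sub>m (n * m) :: complex mat)"
  hence ij: "i < n * m" "j < n * m" by auto
  hence m: "0 < m" by (auto intro: gr0I)
  have "i = j \<longleftrightarrow> i div m = j div m \<and> i mod m = j mod m" by (metis div_mult_mod_eq)
  then show "kronecker (1\<^sub>m n) (1\<^sub>m m) $$ (i, j) = 1\<^sub>m (n * m) $$ (i, j)"
    using ij m by (auto simp: kronecker_def less_mult_imp_div_less)
qed (auto simp: kronecker_def)

lemma mat_trace_kronecker:
  assumes "A \<in> carrier_mat n n" "B \<in> carrier_mat m m"
  shows "mat_trace (kronecker A B) = mat_trace A * mat_trace B"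
proof -
  have "mat_trace (kronecker A B) = (\<Sum>k<n * m. A $$ (k div m, k div m) * B $$ (k mod m, k mod m))"
    using assms unfolding mat_trace_def by (auto simp: kronecker_def intro!: sum.cong)
  also have "\<dots> = (\<Sum>i<n. \<Sum>j<m. A $$ (i, i) * B $$ (j, j))"
  proof (cases "m = 0")
    case False
    then show ?thesis by (subst sum_lessThan_div_mod) auto
  qed simp
  also have "\<dots> = mat_trace A * mat_trace B"
    using assms by (simp add: mat_trace_def sum_product)
  finally show ?thesis .
qed

section \<open>Matrix representations\<close>

lemma GL_carrier_iff:
  "A \<in> carrier (GL n) \<longleftrightarrow>
    A \<in> carrier_mat n n \<and> (\<exists>B\<in>carrier_mat n n. A * B = 1\<^sub>m n \<and> B * A = 1\<^sub>m n)"
  by (auto simp: GL_def units_of_def Units_def ring_mat_simps)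

lemma GL_mult [simp]: "A \<otimes>\<^bsub>GL n\<^esub> B = A * B"
  by (simp add: GL_def units_of_def ring_mat_simps)

lemma GL_one [simp]: "\<one>\<^bsub>GL n\<^esub> = 1\<^sub>m n"
  by (simp add: GL_def units_of_def ring_mat_simps)

lemma group_GL: "group (GL n)"
proof -
  interpret ring "ring_mat TYPE(complex) n ()" by (rule ring_mat)
  show ?thesis unfolding GL_def by (rule units_group)
qed

text \<open>Invertibility of the values is automatic, since \<open>\<rho> (inv g)\<close> inverts
  \<open>\<rho> g\<close>; only sizes, the value at the identity and multiplicativity have to be
  checked.\<close>

lemma (in group) representation_iff:
  "representation G n \<rho> \<longleftrightarrow> (\<forall>g\<in>carrier G. \<rho> g \<in> carrier_mat n n) \<and> \<rho> \<one> = 1\<^sub>m n \<and>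
    (\<forall>g\<in>carrier G. \<forall>h\<in>carrier G. \<rho> (g \<otimes> h) = \<rho> g * \<rho> h)" (is "?L \<longleftrightarrow> ?R")
proof
  assume L: ?L
  hence "\<rho> \<in> hom G (GL n)" by (simp add: representation_def)
  moreover from this have "\<rho> \<one> = 1\<^sub>m n"
    using hom_one[OF _ is_group group_GL] by simp
  ultimately show ?R
    unfolding hom_def by (auto simp: GL_carrier_iff Pi_iff)
next
  assume R: ?R
  have "\<exists>B\<in>carrier_mat n n. \<rho> g * B = 1\<^sub>m n \<and> B * \<rho> g = 1\<^sub>m n" if "g \<in> carrier G" for g
    using R that by (intro bexI[of _ "\<rho> (inv g)"]) (metis inv_closed r_inv l_inv)+
  then show ?L using R unfolding representation_def hom_def by (auto simp: GL_carrier_iff)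
qed

context group begin

lemma rep_carrier: "representation G n \<rho> \<Longrightarrow> g \<in> carrier G \<Longrightarrow> \<rho> g \<in> carrier_mat n n"
  and rep_one: "representation G n \<rho> \<Longrightarrow> \<rho> \<one> = 1\<^sub>m n"
  and rep_mult: "representation G n \<rho> \<Longrightarrow> g \<in> carrier G \<Longrightarrow> h \<in> carrier G \<Longrightarrow> \<rho> (g \<otimes> h) = \<rho> g * \<rho> h"
  by (auto simp: representation_iff)

lemma representationI:
  assumes "\<And>g. g \<in> carrier G \<Longrightarrow> \<rho> g \<in> carrier_mat n n" "\<rho> \<one> = 1\<^sub>m n"
    "\<And>g h. g \<in> carrier G \<Longrightarrow> h \<in> carrier G \<Longrightarrow> \<rho> (g \<otimes> h) = \<rho> g * \<rho> h"
  shows "representation G n \<rho>"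
  using assms by (auto simp: representation_iff)

lemma rep_inv:
  assumes "representation G n \<rho>" "g \<in> carrier G"
  shows "\<rho> g * \<rho> (inv g) = 1\<^sub>m n" "\<rho> (inv g) * \<rho> g = 1\<^sub>m n"
  using assms by (simp_all flip: rep_mult add: rep_one)

lemma rep_dim_unique: "representation G n \<rho> \<Longrightarrow> representation G m \<rho> \<Longrightarrow> n = m"
  using rep_carrier[of n \<rho> \<one>] rep_carrier[of m \<rho> \<one>] by auto

lemma rep_isoI:
  assumes "representation G n \<rho>" "representation G n \<sigma>" "P \<in> carrier_mat n n" "Q \<in> carrier_mat n n"
    "P * Q = 1\<^sub>m n" "Q * P = 1\<^sub>m n" "\<And>g. g \<in> carrier G \<Longrightarrow> P * \<rho> g = \<sigma> g * P"
  shows "rep_iso G \<rho> \<sigma>"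
  using assms unfolding rep_iso_def
  by (intro exI[of _ n] conjI bexI[of _ P]) (auto simp: GL_carrier_iff)

lemma rep_isoE:
  assumes "rep_iso G \<rho> \<sigma>"
  obtains n P Q where "representation G n \<rho>" "representation G n \<sigma>" "P \<in> carrier_mat n n"
    "Q \<in> carrier_mat n n" "P * Q = 1\<^sub>m n" "Q * P = 1\<^sub>m n"
    "\<And>g. g \<in> carrier G \<Longrightarrow> P * \<rho> g = \<sigma> g * P"
    "\<And>g. g \<in> carrier G \<Longrightarrow> \<rho> g = Q * \<sigma> g * P"
    "\<And>g. g \<in> carrier G \<Longrightarrow> Q * \<sigma> g = \<rho> g * Q"
proof -
  from assms obtain n P Q where *: "representation G n \<rho>" "representation G n \<sigma>" "P \<in> carrier_mat n n"
    "Q \<in> carrier_mat n n" "P * Q = 1\<^sub>m n" "Q * P = 1\<^sub>m n"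
    "\<And>g. g \<in> carrier G \<Longrightarrow> P * \<rho> g = \<sigma> g * P"
    unfolding rep_iso_def by (auto simp: GL_carrier_iff)
  have 8: "\<rho> g = Q * \<sigma> g * P" if g: "g \<in> carrier G" for g
  proof -
    note c = rep_carrier[OF *(1) g] rep_carrier[OF *(2) g] *(3,4)
    have "Q * \<sigma> g * P = Q * (P * \<rho> g)" using c *(7)[OF g] by (simp add: assoc_mult_mat[of _ n n _ n _ n])
    also have "\<dots> = \<rho> g" using c *(6) by (simp flip: assoc_mult_mat[of _ n n _ n _ n])
    finally show ?thesis ..
  qed
  have 9: "Q * \<sigma> g = \<rho> g * Q" if g: "g \<in> carrier G" for g
  proof -
    note c = rep_carrier[OF *(1) g] rep_carrier[OF *(2) g] *(3,4)
    have "\<rho> g * Q = Q * \<sigma> g * (P * Q)" unfolding 8[OF g] using c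
      by (simp add: assoc_mult_mat[of _ n n _ n _ n])
    then show ?thesis using c *(5) by simp
  qed
  show thesis using that * 8 9 by blast
qed

lemma rep_iso_refl: "representation G n \<rho> \<Longrightarrow> rep_iso G \<rho> \<rho>"
  by (rule rep_isoI[of n _ _ "1\<^sub>m n" "1\<^sub>m n"]) (auto dest: rep_carrier)

lemma rep_iso_sym: "rep_iso G \<rho> \<sigma> \<Longrightarrow> rep_iso G \<sigma> \<rho>"
  by (elim rep_isoE) (rule rep_isoI)

lemma rep_iso_trans:
  assumes "rep_iso G \<rho> \<sigma>" "rep_iso G \<sigma> \<tau>" shows "rep_iso G \<rho> \<tau>"
proof -
  obtain n P Q where 1: "representation G n \<rho>" "representation G n \<sigma>" "P \<in> carrier_mat n n"
    "Q \<in> carrier_mat n n" "P * Q = 1\<^sub>m n" "Q * P = 1\<^sub>m n"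
    "\<And>g. g \<in> carrier G \<Longrightarrow> P * \<rho> g = \<sigma> g * P"
    using assms(1) by (rule rep_isoE) blast
  obtain m R S where 2: "representation G m \<sigma>" "representation G m \<tau>" "R \<in> carrier_mat m m"
    "S \<in> carrier_mat m m" "R * S = 1\<^sub>m m" "S * R = 1\<^sub>m m"
    "\<And>g. g \<in> carrier G \<Longrightarrow> R * \<sigma> g = \<tau> g * R"
    using assms(2) by (rule rep_isoE) blast
  have [simp]: "m = n" using rep_dim_unique 1 2 by blast
  note a = assoc_mult_mat[of _ n n _ n _ n]
  note c = 1(3,4) 2(3,4)
  show ?thesis
  proof (rule rep_isoI[of n _ _ "R * P" "Q * S"])
    have "R * P * (Q * S) = R * ((P * Q) * S)" using c by (simp add: a)
    also have "\<dots> = R * S" unfolding 1(5) using c by simp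
    finally show "R * P * (Q * S) = 1\<^sub>m n" using 2 by simp
    have "Q * S * (R * P) = Q * ((S * R) * P)" using c by (simp add: a)
    also have "\<dots> = Q * P" unfolding 2(6) using c by simp
    finally show "Q * S * (R * P) = 1\<^sub>m n" using 1 by simp
    fix g assume g: "g \<in> carrier G"
    note d = c rep_carrier[OF 1(1) g] rep_carrier[OF 1(2) g] rep_carrier[OF 2(2) g]
    have "R * P * \<rho> g = R * (P * \<rho> g)" using d by (simp add: a)
    also have "\<dots> = R * \<sigma> g * P" unfolding 1(7)[OF g] using d by (simp add: a)
    also have "\<dots> = \<tau> g * (R * P)" unfolding 2(7)[OF g] using d by (simp add: a)
    finally show "R * P * \<rho> g = \<tau> g * (R * P)" .
  qed (use 1 2 in auto)
qed

lemma representation_tensor: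
  assumes "representation G n \<rho>" "representation G m \<sigma>"
  shows "representation G (n * m) (tensor_rep \<rho> \<sigma>)"
proof (rule representationI)
  fix g h assume "g \<in> carrier G" "h \<in> carrier G"
  then show "tensor_rep \<rho> \<sigma> (g \<otimes> h) = tensor_rep \<rho> \<sigma> g * tensor_rep \<rho> \<sigma> h"
    using assms by (simp add: tensor_rep_def rep_mult
        kronecker_mult[of _ n n _ n _ m m _ m] rep_carrier)
qed (use assms in \<open>auto simp: tensor_rep_def rep_one kronecker_one intro: kronecker_carrier rep_carrier\<close>)

end

section \<open>Characters and direct sums\<close>

definition character :: "('g \<Rightarrow> complex mat) \<Rightarrow> 'g \<Rightarrow> complex" where
  "character \<rho> g = mat_trace (\<rho> g)"

lemma (in group) character_tensor:
  assumes "representation G n \<rho>" "representation G m \<sigma>" "g \<in> carrier G"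
  shows "character (tensor_rep \<rho> \<sigma>) g = character \<rho> g * character \<sigma> g"
  unfolding character_def tensor_rep_def
  using assms by (auto intro: mat_trace_kronecker rep_carrier)

lemma (in group) character_iso:
  assumes "rep_iso G \<rho> \<sigma>" "g \<in> carrier G"
  shows "character \<rho> g = character \<sigma> g"
proof -
  obtain n P Q where *: "representation G n \<rho>" "representation G n \<sigma>" "P \<in> carrier_mat n n"
    "Q \<in> carrier_mat n n" "P * Q = 1\<^sub>m n"
    "\<And>g. g \<in> carrier G \<Longrightarrow> \<rho> g = Q * \<sigma> g * P"
    using assms(1) by (rule rep_isoE) blast
  note c = *(3,4) rep_carrier[OF *(2) assms(2)]
  have "mat_trace (\<rho> g) = mat_trace (P * (Q * \<sigma> g))"
    unfolding *(6)[OF assms(2)] using c by (intro mat_trace_comm) auto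
  also have "P * (Q * \<sigma> g) = \<sigma> g" using c *(5) by (simp flip: assoc_mult_mat[of _ n n _ n _ n])
  finally show ?thesis by (simp add: character_def)
qed

text \<open>The zero blocks take their sizes from the values instead of from dimension parameters.
  Thus \<open>direct_sum_rep\<close> of a \<open>Cons\<close> or an append is literally a block sum,
  as an equality of functions without side conditions.\<close>

definition block_sum_rep :: "('g \<Rightarrow> complex mat) \<Rightarrow> ('g \<Rightarrow> complex mat) \<Rightarrow> 'g \<Rightarrow> complex mat" where
  "block_sum_rep \<rho> \<sigma> = (\<lambda>g. four_block_mat (\<rho> g) (0\<^sub>m (dim_row (\<rho> g)) (dim_col (\<sigma> g)))
     (0\<^sub>m (dim_row (\<sigma> g)) (dim_col (\<rho> g))) (\<sigma> g))"

lemma direct_sum_rep_append: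
  "direct_sum_rep (\<rho>s @ \<sigma>s) = block_sum_rep (direct_sum_rep \<rho>s) (direct_sum_rep \<sigma>s)"
  by (simp add: direct_sum_rep_def block_sum_rep_def diag_block_mat_append Let_def)

lemma direct_sum_rep_Cons:
  "direct_sum_rep (\<rho> # \<sigma>s) = block_sum_rep \<rho> (direct_sum_rep \<sigma>s)"
  by (simp add: direct_sum_rep_def block_sum_rep_def Let_def)

lemma direct_sum_rep_Nil: "direct_sum_rep [] = (\<lambda>g. 0\<^sub>m 0 0)"
  by (simp add: direct_sum_rep_def)

lemma direct_sum_rep_single: "direct_sum_rep [\<rho>] = \<rho>"
  by (intro ext eq_matI) (auto simp: direct_sum_rep_def)

context group begin

lemma block_sum_rep_apply:
  assumes "representation G n \<rho>" "representation G m \<sigma>" "g \<in> carrier G"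
  shows "block_sum_rep \<rho> \<sigma> g = four_block_mat (\<rho> g) (0\<^sub>m n m) (0\<^sub>m m n) (\<sigma> g)"
  using assms by (auto simp: block_sum_rep_def dest!: rep_carrier)

lemma representation_block_sum:
  assumes "representation G n \<rho>" "representation G m \<sigma>"
  shows "representation G (n + m) (block_sum_rep \<rho> \<sigma>)"
proof (rule representationI)
  fix g h assume g: "g \<in> carrier G" and h: "h \<in> carrier G"
  note c = rep_carrier[OF assms(1) g] rep_carrier[OF assms(1) h]
    rep_carrier[OF assms(2) g] rep_carrier[OF assms(2) h]
  show "block_sum_rep \<rho> \<sigma> (g \<otimes> h) = block_sum_rep \<rho> \<sigma> g * block_sum_rep \<rho> \<sigma> h"
    using c g h assms by (simp add: block_sum_rep_apply rep_mult mult_four_block_mat[of _ n n _ m _ m _ _ n _ m])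
qed (use assms in \<open>auto simp: block_sum_rep_apply rep_one intro: four_block_carrier_mat rep_carrier\<close>)

lemma character_block_sum:
  assumes "representation G n \<rho>" "representation G m \<sigma>" "g \<in> carrier G"
  shows "character (block_sum_rep \<rho> \<sigma>) g = character \<rho> g + character \<sigma> g"
  using assms by (simp add: character_def block_sum_rep_apply mat_trace_four_block[of _ n _ m] rep_carrier)

lemma rep_iso_block_sum:
  assumes "rep_iso G \<rho> \<rho>'" "rep_iso G \<sigma> \<sigma>'"
  shows "rep_iso G (block_sum_rep \<rho> \<sigma>) (block_sum_rep \<rho>' \<sigma>')"
proof -
  obtain n P Q where 1: "representation G n \<rho>" "representation G n \<rho>'" "P \<in> carrier_mat n n"
    "Q \<in> carrier_mat n n" "P * Q = 1\<^sub>m n" "Q * P = 1\<^sub>m n"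
    "\<And>g. g \<in> carrier G \<Longrightarrow> P * \<rho> g = \<rho>' g * P"
    using assms(1) by (rule rep_isoE) blast
  obtain m R S where 2: "representation G m \<sigma>" "representation G m \<sigma>'" "R \<in> carrier_mat m m"
    "S \<in> carrier_mat m m" "R * S = 1\<^sub>m m" "S * R = 1\<^sub>m m"
    "\<And>g. g \<in> carrier G \<Longrightarrow> R * \<sigma> g = \<sigma>' g * R"
    using assms(2) by (rule rep_isoE) blast
  note m = mult_four_block_mat[of _ n n _ m _ m _ _ n _ m]
  note c = 1(3,4) 2(3,4)
  show ?thesis
  proof (rule rep_isoI[of "n + m"])
    show "four_block_mat P (0\<^sub>m n m) (0\<^sub>m m n) R \<in> carrier_mat (n + m) (n + m)"
      "four_block_mat Q (0\<^sub>m n m) (0\<^sub>m m n) S \<in> carrier_mat (n + m) (n + m)" using c by auto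
    show "four_block_mat P (0\<^sub>m n m) (0\<^sub>m m n) R * four_block_mat Q (0\<^sub>m n m) (0\<^sub>m m n) S = 1\<^sub>m (n + m)"
      "four_block_mat Q (0\<^sub>m n m) (0\<^sub>m m n) S * four_block_mat P (0\<^sub>m n m) (0\<^sub>m m n) R = 1\<^sub>m (n + m)"
      using c 1 2 by (simp_all add: m)
    fix g assume g: "g \<in> carrier G"
    show "four_block_mat P (0\<^sub>m n m) (0\<^sub>m m n) R * block_sum_rep \<rho> \<sigma> g =
      block_sum_rep \<rho>' \<sigma>' g * four_block_mat P (0\<^sub>m n m) (0\<^sub>m m n) R"
      using c 1(7)[OF g] 2(7)[OF g] 1(1,2) 2(1,2) g rep_carrier[OF 1(1) g] rep_carrier[OF 1(2) g]
        rep_carrier[OF 2(1) g] rep_carrier[OF 2(2) g]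
      by (simp add: m block_sum_rep_apply)
  qed (use 1 2 in \<open>auto intro: representation_block_sum\<close>)
qed

text \<open>The intertwiner is the block permutation matrix that exchanges the two groups of
  coordinates.\<close>

lemma block_sum_rep_commute:
  assumes "representation G n \<rho>" "representation G m \<sigma>"
  shows "rep_iso G (block_sum_rep \<rho> \<sigma>) (block_sum_rep \<sigma> \<rho>)"
proof -
  have P: "four_block_mat (0\<^sub>m a b) (1\<^sub>m a) (1\<^sub>m b) (0\<^sub>m b a) * four_block_mat A (0\<^sub>m b a) (0\<^sub>m a b) B =
      four_block_mat (0\<^sub>m a b) B A (0\<^sub>m b a)"
    if "A \<in> carrier_mat b b" "B \<in> carrier_mat a a" for a b and A B :: "complex mat"
    by (subst mult_four_block_mat[of _ a b _ a _ b _ _ b _ a]) (use that in auto)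
  let ?P = "\<lambda>a b. four_block_mat (0\<^sub>m a b) (1\<^sub>m a) (1\<^sub>m b) (0\<^sub>m b a) :: complex mat"
  have PP: "?P a b * ?P b a = 1\<^sub>m (a + b)" for a b
    by (subst mult_four_block_mat[of _ a b _ a _ b _ _ a _ b]) auto
  have swap: "?P m n * block_sum_rep \<rho> \<sigma> g = block_sum_rep \<sigma> \<rho> g * ?P m n" if g: "g \<in> carrier G" for g
    using rep_carrier[OF assms(1) g] rep_carrier[OF assms(2) g] g assms
    by (simp add: block_sum_rep_apply P mult_four_block_mat[of _ m m _ n _ n _ _ n _ m])
  show ?thesis
  proof (rule rep_isoI[OF representation_block_sum[OF assms]])
    show "representation G (n + m) (block_sum_rep \<sigma> \<rho>)"
      using representation_block_sum[OF assms(2,1)] by (simp add: add.commute)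
    show "?P m n \<in> carrier_mat (n + m) (n + m)" "?P n m \<in> carrier_mat (n + m) (n + m)"
      using four_block_carrier_mat[of "0\<^sub>m m n" m n "0\<^sub>m n m :: complex mat" n m]
        four_block_carrier_mat[of "0\<^sub>m n m" n m "0\<^sub>m m n :: complex mat" m n]
      by (simp_all add: add.commute)
    show "?P m n * ?P n m = 1\<^sub>m (n + m)" "?P n m * ?P m n = 1\<^sub>m (n + m)"
      by (simp_all only: PP add.commute[of m n])
  qed (rule swap)
qed

lemma ex_representation_direct_sum:
  assumes "\<forall>\<tau>\<in>set \<tau>s. \<exists>n. representation G n \<tau>"
  shows "\<exists>n. representation G n (direct_sum_rep \<tau>s)"
  using assms
proof (induction \<tau>s)
  case Nil
  have "representation G 0 (direct_sum_rep [])"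
    by (rule representationI) (auto simp: direct_sum_rep_Nil)
  then show ?case ..
next
  case (Cons \<tau> \<tau>s)
  then show ?case using representation_block_sum by (fastforce simp: direct_sum_rep_Cons)
qed

lemma character_direct_sum:
  assumes "\<forall>\<tau>\<in>set \<tau>s. \<exists>n. representation G n \<tau>" "g \<in> carrier G"
  shows "character (direct_sum_rep \<tau>s) g = (\<Sum>\<tau>\<leftarrow>\<tau>s. character \<tau> g)"
  using assms
proof (induction \<tau>s)
  case Nil
  then show ?case by (simp add: character_def direct_sum_rep_Nil mat_trace_def)
next
  case (Cons \<tau> \<tau>s)
  obtain n m where "representation G n \<tau>" "representation G m (direct_sum_rep \<tau>s)"
    using Cons.prems ex_representation_direct_sum[of \<tau>s] by auto
  from character_block_sum[OF this Cons.prems(2)] Cons show ?case by (simp add: direct_sum_rep_Cons)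
qed

lemma rep_iso_direct_sum_append:
  assumes "rep_iso G (direct_sum_rep \<rho>s) (direct_sum_rep \<rho>s')"
    and "rep_iso G (direct_sum_rep \<sigma>s) (direct_sum_rep \<sigma>s')"
  shows "rep_iso G (direct_sum_rep (\<rho>s @ \<sigma>s)) (direct_sum_rep (\<rho>s' @ \<sigma>s'))"
  using rep_iso_block_sum[OF assms] by (simp add: direct_sum_rep_append)

text \<open>Complete reducibility yields summands in any order, whereas the McKay matrix wants equal
  ones grouped in the order of the list. In the induction the head \<open>\<tau>\<close> is moved
  past the summands \<open>as\<close> that precede it in \<open>\<sigma>s\<close>.\<close>

lemma rep_iso_direct_sum_mset:
  assumes "mset \<rho>s = mset \<sigma>s" "\<forall>\<tau>\<in>set \<rho>s. \<exists>n. representation G n \<tau>"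
  shows "rep_iso G (direct_sum_rep \<rho>s) (direct_sum_rep \<sigma>s)"
  using assms
proof (induction \<rho>s arbitrary: \<sigma>s)
  case Nil
  then show ?case using ex_representation_direct_sum[of "[]"] by (auto intro: rep_iso_refl)
next
  case (Cons \<tau> \<rho>s)
  have "\<tau> \<in> set \<sigma>s" using Cons.prems(1) by (metis list.set_intros(1) set_mset_mset)
  then obtain as bs where \<sigma>s: "\<sigma>s = as @ \<tau> # bs" by (meson split_list)
  have m: "mset \<rho>s = mset (as @ bs)" using Cons.prems(1) by (simp add: \<sigma>s)
  have sub: "set (as @ bs) = set \<rho>s" using mset_eq_setD[OF m] by simp
  hence reps: "\<forall>\<tau>\<in>set as. \<exists>n. representation G n \<tau>" "\<forall>\<tau>\<in>set bs. \<exists>n. representation G n \<tau>"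
    "\<exists>n. representation G n \<tau>"
    using Cons.prems(2) by (auto simp flip: sub)
  then obtain a b c where abc: "representation G a (direct_sum_rep as)"
      "representation G b (direct_sum_rep bs)" "representation G c \<tau>"
    using ex_representation_direct_sum by metis
  have "rep_iso G (direct_sum_rep \<rho>s) (direct_sum_rep (as @ bs))"
    using Cons.IH[OF m] Cons.prems(2) by simp
  hence "rep_iso G (direct_sum_rep (\<tau> # \<rho>s)) (direct_sum_rep ([\<tau>] @ as @ bs))"
    using rep_iso_direct_sum_append[of "[\<tau>]" "[\<tau>]"] rep_iso_refl[OF abc(3)]
    by (simp add: direct_sum_rep_single)
  moreover have "rep_iso G (direct_sum_rep ([\<tau>] @ as)) (direct_sum_rep (as @ [\<tau>]))"
    using block_sum_rep_commute[OF abc(3,1)]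
    by (simp only: direct_sum_rep_append direct_sum_rep_single)
  from rep_iso_direct_sum_append[OF this rep_iso_refl[OF abc(2)]]
  have "rep_iso G (direct_sum_rep ([\<tau>] @ as @ bs)) (direct_sum_rep (as @ \<tau> # bs))" by simp
  ultimately have "rep_iso G (direct_sum_rep (\<tau> # \<rho>s)) (direct_sum_rep (as @ \<tau> # bs))"
    by (rule rep_iso_trans)
  then show ?case by (simp add: \<sigma>s)
qed

end

section \<open>Schur's lemma and orthogonality\<close>

lemma subspace_vecI:
  assumes "W \<subseteq> carrier_vec n" "0\<^sub>v n \<in> W" "\<And>v w. v \<in> W \<Longrightarrow> w \<in> W \<Longrightarrow> v + w \<in> W"
    "\<And>c v. v \<in> W \<Longrightarrow> c \<cdot>\<^sub>v v \<in> W"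
  shows "VectorSpace.subspace class_ring W (module_vec TYPE('a :: field) n)"
proof -
  interpret vec_space "TYPE('a)" n .
  show ?thesis
    using assms vec_vs[of n, where 'a = 'a] vec_module[of n, where 'a = 'a]
    unfolding VectorSpace.subspace_def LinearCombinations.submodule_def by (auto simp: module_vec_simps)
qed

lemma index_mult_mat_sum:
  assumes "A \<in> carrier_mat a b" "B \<in> carrier_mat b c" "i < a" "j < c"
  shows "(A * B) $$ (i, j) = (\<Sum>l<b. A $$ (i, l) * B $$ (l, j))"
  using assms by (simp add: scalar_prod_def lessThan_atLeast0)

lemma mat_eq_0I:
  fixes X :: "'a :: comm_ring_1 mat"
  assumes "X \<in> carrier_mat m n" "\<And>v. v \<in> carrier_vec n \<Longrightarrow> X *\<^sub>v v = 0\<^sub>v m"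
  shows "X = 0\<^sub>m m n"
proof (rule eq_matI)
  fix i j assume "i < dim_row (0\<^sub>m m n :: 'a mat)" "j < dim_col (0\<^sub>m m n :: 'a mat)"
  hence ij: "i < m" "j < n" by auto
  have "X $$ (i, j) = (X *\<^sub>v unit_vec n j) $ i" using ij assms(1) by simp
  also have "\<dots> = 0" using assms(2)[of "unit_vec n j"] ij by simp
  finally show "X $$ (i, j) = 0\<^sub>m m n $$ (i, j)" using ij by simp
qed (use assms in auto)

context group begin

lemma irrep_rep: "irreducible_representation G n \<sigma> \<Longrightarrow> representation G n \<sigma>"
  by (simp add: irreducible_representation_def)

text \<open>Kernel and image of an intertwiner are invariant, so a nonzero \<open>X\<close> has zero
  kernel and full image. The dimensions agree because \<open>X * Y\<close> and \<open>Y * X\<close>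
  are identity matrices with equal trace.\<close>

lemma schur:
  assumes \<sigma>: "irreducible_representation G n \<sigma>" and \<tau>: "irreducible_representation G m \<tau>"
    and X: "X \<in> carrier_mat m n" "\<And>g. g \<in> carrier G \<Longrightarrow> X * \<sigma> g = \<tau> g * X" "X \<noteq> 0\<^sub>m m n"
  obtains Y where "n = m" "Y \<in> carrier_mat n m" "X * Y = 1\<^sub>m m" "Y * X = 1\<^sub>m n"
proof -
  note c = rep_carrier[OF irrep_rep[OF \<sigma>]] rep_carrier[OF irrep_rep[OF \<tau>]] X(1)
  define K where "K = {v \<in> carrier_vec n. X *\<^sub>v v = 0\<^sub>v m}"
  define I where "I = (\<lambda>v. X *\<^sub>v v) ` carrier_vec n"
  have intertw: "X *\<^sub>v (\<sigma> g *\<^sub>v v) = \<tau> g *\<^sub>v (X *\<^sub>v v)" if "g \<in> carrier G" "v \<in> carrier_vec n" for g v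
    using c that X(2)[OF that(1)] by (simp flip: assoc_mult_mat_vec[of _ m n _ n] assoc_mult_mat_vec[of _ m m _ n])
  have "VectorSpace.subspace class_ring K (module_vec TYPE(complex) n)"
    by (rule subspace_vecI) (use X(1) in \<open>auto simp: K_def mult_add_distrib_mat_vec mult_mat_vec\<close>)
  moreover have "\<sigma> g *\<^sub>v w \<in> K" if "g \<in> carrier G" "w \<in> K" for g w
    using that c(1,2)[OF that(1)] intertw[of g w] by (auto simp: K_def)
  ultimately have "K = {0\<^sub>v n} \<or> K = carrier_vec n"
    using \<sigma> unfolding irreducible_representation_def by blast
  moreover have "K \<noteq> carrier_vec n" using mat_eq_0I[OF X(1)] X(3) unfolding K_def by blast
  ultimately have K: "K = {0\<^sub>v n}" by blast
  have "VectorSpace.subspace class_ring I (module_vec TYPE(complex) m)"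
  proof (rule subspace_vecI)
    show "0\<^sub>v m \<in> I" unfolding I_def by (rule image_eqI[of _ _ "0\<^sub>v n"]) (use X in auto)
    show "v + w \<in> I" if vw: "v \<in> I" "w \<in> I" for v w
    proof -
      obtain v' w' where "v = X *\<^sub>v v'" "w = X *\<^sub>v w'" "v' \<in> carrier_vec n" "w' \<in> carrier_vec n"
        using vw unfolding I_def by blast
      then show ?thesis unfolding I_def
        by (intro image_eqI[of _ _ "v' + w'"]) (simp_all add: mult_add_distrib_mat_vec[OF X(1)])
    qed
    show "k \<cdot>\<^sub>v v \<in> I" if v: "v \<in> I" for k v
    proof -
      obtain v' where "v = X *\<^sub>v v'" "v' \<in> carrier_vec n" using v unfolding I_def by blast
      then show ?thesis unfolding I_def
        by (intro image_eqI[of _ _ "k \<cdot>\<^sub>v v'"]) (simp_all add: mult_mat_vec[OF X(1)])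
    qed
  qed (use X in \<open>auto simp: I_def\<close>)
  moreover have "\<tau> g *\<^sub>v w \<in> I" if g: "g \<in> carrier G" "w \<in> I" for g w
  proof -
    obtain v where v: "v \<in> carrier_vec n" "w = X *\<^sub>v v" using g unfolding I_def by blast
    have "\<tau> g *\<^sub>v w = X *\<^sub>v (\<sigma> g *\<^sub>v v)" using intertw g v by simp
    then show ?thesis using c(1)[OF g(1)] v unfolding I_def by (intro image_eqI[of _ _ "\<sigma> g *\<^sub>v v"]) auto
  qed
  ultimately have "I = {0\<^sub>v m} \<or> I = carrier_vec m"
    using \<tau> unfolding irreducible_representation_def by blast
  moreover have "I \<noteq> {0\<^sub>v m}" using mat_eq_0I[OF X(1)] X(3) unfolding I_def by blast
  ultimately have I: "I = carrier_vec m" by blast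
  have "\<exists>y. y \<in> carrier_vec n \<and> X *\<^sub>v y = v" if "v \<in> carrier_vec m" for v
  proof -
    have "v \<in> I" using I that by simp
    then show ?thesis unfolding I_def by auto
  qed
  then obtain y where y: "\<And>v. v \<in> carrier_vec m \<Longrightarrow> y v \<in> carrier_vec n \<and> X *\<^sub>v y v = v" by metis
  define Y where "Y = mat_of_cols n (map (\<lambda>i. y (unit_vec m i)) [0..<m])"
  have Y: "Y \<in> carrier_mat n m" unfolding Y_def by auto
  have XY: "X * Y = 1\<^sub>m m"
  proof (rule mat_col_eqI)
    fix i assume "i < dim_col (1\<^sub>m m :: complex mat)"
    hence i: "i < m" by simp
    have "col Y i = y (unit_vec m i)"
      unfolding Y_def using i y[of "unit_vec m i"] by (subst col_mat_of_cols) simp_all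
    then show "col (X * Y) i = col (1\<^sub>m m) i" using y[of "unit_vec m i"] i
      unfolding col_mult2[OF X(1) Y i] by simp
  qed (use X Y in auto)
  have YX: "Y * X = 1\<^sub>m n"
  proof -
    \<comment> \<open>\<open>X * ?Z = 0\<close> puts all values of \<open>?Z\<close> into the zero
      kernel \<open>K\<close>. So the right inverse is also a left inverse before
      \<open>n = m\<close> is known.\<close>
    let ?Z = "Y * X - 1\<^sub>m n"
    have Z: "?Z \<in> carrier_mat n n" using Y X by auto
    have "X * ?Z = X * Y * X - X"
      using X(1) Y by (simp add: mult_minus_distrib_mat[of _ m n _ n] assoc_mult_mat[of _ m n _ m _ n])
    also have "\<dots> = 0\<^sub>m m n" using XY X(1) by simp
    finally have XZ: "X * ?Z = 0\<^sub>m m n" .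
    have "?Z = 0\<^sub>m n n"
    proof (rule mat_eq_0I[OF Z])
      fix v :: "complex vec" assume v: "v \<in> carrier_vec n"
      have "X *\<^sub>v (?Z *\<^sub>v v) = 0\<^sub>m m n *\<^sub>v v"
        using XZ v X(1) Z by (simp flip: assoc_mult_mat_vec[of _ m n _ n])
      also have "\<dots> = 0\<^sub>v m" using v by (intro eq_vecI) auto
      finally have "X *\<^sub>v (?Z *\<^sub>v v) = 0\<^sub>v m" .
      hence "?Z *\<^sub>v v \<in> K" unfolding K_def using Z v by auto
      then show "?Z *\<^sub>v v = 0\<^sub>v n" using K by blast
    qed
    then have "?Z + 1\<^sub>m n = 1\<^sub>m n" by simp
    moreover have "?Z + 1\<^sub>m n = Y * X" using X Y by (intro eq_matI) auto
    ultimately show ?thesis by simp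
  qed
  have "n = m"
    using mat_trace_comm[OF X(1) Y] by (simp add: XY YX)
  with Y XY YX that show thesis by blast
qed

lemma schur_not_iso:
  assumes \<sigma>: "irreducible_representation G n \<sigma>" and \<tau>: "irreducible_representation G m \<tau>"
    and X: "X \<in> carrier_mat m n" "\<And>g. g \<in> carrier G \<Longrightarrow> X * \<sigma> g = \<tau> g * X"
    and "\<not> rep_iso G \<sigma> \<tau>"
  shows "X = 0\<^sub>m m n"
proof (rule ccontr)
  assume "X \<noteq> 0\<^sub>m m n"
  with schur[OF \<sigma> \<tau> X] obtain Y where "n = m" "Y \<in> carrier_mat n m" "X * Y = 1\<^sub>m m" "Y * X = 1\<^sub>m n"
    by blast
  then have "rep_iso G \<sigma> \<tau>"
    using X \<sigma> \<tau> by (intro rep_isoI[of n _ _ X Y]) (auto dest: irrep_rep)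
  with assms show False by blast
qed

text \<open>Over the complex numbers \<open>X\<close> has an eigenvalue \<open>c\<close>;
  subtracting \<open>c\<close> times the identity leaves an intertwiner that kills a nonzero vector,
  which is zero by \<open>schur\<close>.\<close>

lemma schur_scalar:
  assumes \<sigma>: "irreducible_representation G n \<sigma>"
    and X: "X \<in> carrier_mat n n" "\<And>g. g \<in> carrier G \<Longrightarrow> X * \<sigma> g = \<sigma> g * X"
  obtains c where "X = c \<cdot>\<^sub>m 1\<^sub>m n"
proof -
  have "n \<noteq> 0" using \<sigma> unfolding irreducible_representation_def by blast
  then obtain c where "eigenvalue X c" using spectrum_non_empty[OF X(1)] unfolding spectrum_def by auto
  then obtain v where v: "v \<in> carrier_vec n" "v \<noteq> 0\<^sub>v n" "X *\<^sub>v v = c \<cdot>\<^sub>v v"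
    using X(1) unfolding eigenvalue_def eigenvector_def by auto
  define Z where "Z = X - c \<cdot>\<^sub>m 1\<^sub>m n"
  have Z: "Z \<in> carrier_mat n n" using X(1) unfolding Z_def by auto
  have comm: "Z * \<sigma> g = \<sigma> g * Z" if g: "g \<in> carrier G" for g
    using rep_carrier[OF irrep_rep[OF \<sigma>] g] X(1) X(2)[OF g] unfolding Z_def
    by (simp add: minus_mult_distrib_mat[of _ n n _ _ n] mult_minus_distrib_mat[of _ n n _ n]
        mult_smult_assoc_mat[of _ n n _ n] mult_smult_distrib[of _ n n _ n])
  have "(c \<cdot>\<^sub>m 1\<^sub>m n) *\<^sub>v v = c \<cdot>\<^sub>v v" using v by (intro eq_vecI) auto
  hence Zv: "Z *\<^sub>v v = 0\<^sub>v n"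
    using v X(1) unfolding Z_def by (simp add: minus_mult_distrib_mat_vec[of _ n n])
  have "Z = 0\<^sub>m n n"
  proof (rule ccontr)
    assume "Z \<noteq> 0\<^sub>m n n"
    with schur[OF \<sigma> \<sigma> Z comm] obtain Y where "Y \<in> carrier_mat n n" "Y * Z = 1\<^sub>m n" by blast
    then have "v = Y *\<^sub>v (Z *\<^sub>v v)" using Z v by (simp flip: assoc_mult_mat_vec[of _ n n _ n])
    moreover have "Y *\<^sub>v 0\<^sub>v n = 0\<^sub>v n"
      using \<open>Y \<in> carrier_mat n n\<close> by (intro eq_vecI) auto
    ultimately show False using Zv v by simp
  qed
  moreover have "Z + c \<cdot>\<^sub>m 1\<^sub>m n = X" using X(1) unfolding Z_def by (intro eq_matI) auto
  ultimately show thesis using that[of c] by simp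
qed

end

section \<open>Sums over the group and orthogonality relations\<close>

definition mat_sum :: "nat \<Rightarrow> nat \<Rightarrow> ('b \<Rightarrow> 'a :: comm_ring_1 mat) \<Rightarrow> 'b set \<Rightarrow> 'a mat" where
  "mat_sum a b F A = mat a b (\<lambda>ij. \<Sum>h\<in>A. F h $$ ij)"

lemma mat_sum_carrier [simp]: "mat_sum a b F A \<in> carrier_mat a b"
  by (simp add: mat_sum_def)

lemma mult_mat_sum:
  assumes "Y \<in> carrier_mat c a" "\<And>h. h \<in> A \<Longrightarrow> F h \<in> carrier_mat a b"
  shows "Y * mat_sum a b F A = mat_sum c b (\<lambda>h. Y * F h) A"
proof (rule eq_matI)
  fix i j assume "i < dim_row (mat_sum c b (\<lambda>h. Y * F h) A)" "j < dim_col (mat_sum c b (\<lambda>h. Y * F h) A)"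
  hence ij: "i < c" "j < b" by (auto simp: mat_sum_def)
  have "(Y * mat_sum a b F A) $$ (i, j) = (\<Sum>l<a. \<Sum>h\<in>A. Y $$ (i, l) * F h $$ (l, j))"
    using assms(1) ij by (simp add: mat_sum_def scalar_prod_def lessThan_atLeast0 sum_distrib_left)
  also have "\<dots> = (\<Sum>h\<in>A. \<Sum>l<a. Y $$ (i, l) * F h $$ (l, j))" by (rule sum.swap)
  also have "\<dots> = mat_sum c b (\<lambda>h. Y * F h) A $$ (i, j)"
    using assms ij by (auto simp: mat_sum_def scalar_prod_def lessThan_atLeast0 carrier_matD[OF assms(2)] intro!: sum.cong)
  finally show "(Y * mat_sum a b F A) $$ (i, j) = mat_sum c b (\<lambda>h. Y * F h) A $$ (i, j)" .
qed (use assms in \<open>auto simp: mat_sum_def\<close>)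

lemma mat_sum_mult:
  assumes "Y \<in> carrier_mat b c" "\<And>h. h \<in> A \<Longrightarrow> F h \<in> carrier_mat a b"
  shows "mat_sum a b F A * Y = mat_sum a c (\<lambda>h. F h * Y) A"
proof (rule eq_matI)
  fix i j assume "i < dim_row (mat_sum a c (\<lambda>h. F h * Y) A)" "j < dim_col (mat_sum a c (\<lambda>h. F h * Y) A)"
  hence ij: "i < a" "j < c" by (auto simp: mat_sum_def)
  have "(mat_sum a b F A * Y) $$ (i, j) = (\<Sum>l<b. \<Sum>h\<in>A. F h $$ (i, l) * Y $$ (l, j))"
    using assms(1) ij by (simp add: mat_sum_def scalar_prod_def lessThan_atLeast0 sum_distrib_right)
  also have "\<dots> = (\<Sum>h\<in>A. \<Sum>l<b. F h $$ (i, l) * Y $$ (l, j))" by (rule sum.swap)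
  also have "\<dots> = mat_sum a c (\<lambda>h. F h * Y) A $$ (i, j)"
    using assms ij by (auto simp: mat_sum_def scalar_prod_def lessThan_atLeast0 carrier_matD[OF assms(2)] intro!: sum.cong)
  finally show "(mat_sum a b F A * Y) $$ (i, j) = mat_sum a c (\<lambda>h. F h * Y) A $$ (i, j)" .
qed (use assms in \<open>auto simp: mat_sum_def\<close>)

lemma mat_sum_cong: "(\<And>h. h \<in> A \<Longrightarrow> F h = F' h) \<Longrightarrow> mat_sum a b F A = mat_sum a b F' A"
  by (auto simp: mat_sum_def intro!: cong_mat sum.cong)

lemma (in group) sum_translate:
  assumes "h \<in> carrier G"
  shows "(\<Sum>g\<in>carrier G. f (h \<otimes> g)) = (\<Sum>g\<in>carrier G. f g)"
  by (rule sum.reindex_bij_witness[of _ "\<lambda>g. inv h \<otimes> g" "\<lambda>g. h \<otimes> g"])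
    (use assms in \<open>auto simp flip: m_assoc\<close>)

lemma (in group) mat_sum_translate:
  assumes "h \<in> carrier G"
  shows "mat_sum a b (\<lambda>g. F (h \<otimes> g)) (carrier G) = mat_sum a b F (carrier G)"
  unfolding mat_sum_def using sum_translate[OF assms] by (intro cong_mat) auto

locale finite_group = group +
  assumes finite_carrier: "finite (carrier G)"
begin

lemma card_carrier_pos: "0 < card (carrier G)"
  using finite_carrier by (auto simp: card_gt_0_iff)

text \<open>\<open>T\<close> is the sum of \<open>\<sigma> g * E * \<tau> (inv g)\<close> over the
  group, written out in entries, where \<open>E\<close> is the matrix unit at \<open>(b, c)\<close>.
  Translating the summation variable by \<open>h\<close> moves \<open>\<sigma> h\<close> across it.
  Letting \<open>E\<close> run through the matrix units is what gives relations between individual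
  coefficients.\<close>

lemma average_intertwines:
  assumes \<sigma>: "representation G n \<sigma>" and \<tau>: "representation G m \<tau>" and b: "b < n" and c: "c < m"
  defines "T \<equiv> mat n m (\<lambda>(i, j). \<Sum>g\<in>carrier G. \<sigma> g $$ (i, b) * \<tau> (inv g) $$ (c, j))"
  assumes h: "h \<in> carrier G"
  shows "T * \<tau> h = \<sigma> h * T"
proof -
  define E where "E = mat n m (\<lambda>(k, l). if k = b \<and> l = c then 1 else 0 :: complex)"
  have E: "E \<in> carrier_mat n m" by (simp add: E_def)
  let ?F = "\<lambda>g. \<sigma> g * E * \<tau> (inv g)"
  have F: "?F g \<in> carrier_mat n m" if "g \<in> carrier G" for g
    using that rep_carrier[OF \<sigma> that] rep_carrier[OF \<tau> inv_closed[OF that]] E by simp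
  have "?F g $$ (i, j) = \<sigma> g $$ (i, b) * \<tau> (inv g) $$ (c, j)" if "g \<in> carrier G" "i < n" "j < m" for g i j
  proof -
    note car = rep_carrier[OF \<sigma> that(1)] rep_carrier[OF \<tau> inv_closed[OF that(1)]] E
    have "?F g $$ (i, j) = (\<Sum>l<m. (\<sigma> g * E) $$ (i, l) * \<tau> (inv g) $$ (l, j))"
      using car that by (intro index_mult_mat_sum) auto
    also have "\<dots> = (\<Sum>l<m. (if l = c then \<sigma> g $$ (i, b) else 0) * \<tau> (inv g) $$ (l, j))"
    proof (rule sum.cong)
      fix l assume "l \<in> {..<m}"
      hence l: "l < m" by simp
      have "(\<sigma> g * E) $$ (i, l) = (\<Sum>k<n. \<sigma> g $$ (i, k) * E $$ (k, l))"
        using car that l by (intro index_mult_mat_sum) auto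
      also have "\<dots> = (\<Sum>k<n. if k = b then (if l = c then \<sigma> g $$ (i, k) else 0) else 0)"
        using l by (intro sum.cong) (auto simp: E_def)
      also have "\<dots> = (if l = c then \<sigma> g $$ (i, b) else 0)" using b by simp
      finally show "(\<sigma> g * E) $$ (i, l) * \<tau> (inv g) $$ (l, j) =
          (if l = c then \<sigma> g $$ (i, b) else 0) * \<tau> (inv g) $$ (l, j)" by simp
    qed simp
    also have "\<dots> = (\<Sum>l<m. if l = c then \<sigma> g $$ (i, b) * \<tau> (inv g) $$ (l, j) else 0)"
      by (intro sum.cong) auto
    also have "\<dots> = \<sigma> g $$ (i, b) * \<tau> (inv g) $$ (c, j)" using c by simp
    finally show ?thesis .
  qed
  hence T: "T = mat_sum n m ?F (carrier G)"
    unfolding T_def mat_sum_def by (intro cong_mat) auto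
  have "\<sigma> h * T = mat_sum n m (\<lambda>g. \<sigma> h * ?F g) (carrier G)"
    unfolding T by (rule mult_mat_sum[OF rep_carrier[OF \<sigma> h] F])
  also have "\<dots> = mat_sum n m (\<lambda>g. ?F (h \<otimes> g) * \<tau> h) (carrier G)"
  proof (rule mat_sum_cong)
    fix g assume g: "g \<in> carrier G"
    note car = rep_carrier[OF \<sigma> g] rep_carrier[OF \<sigma> h] E rep_carrier[OF \<tau> inv_closed[OF g]]
      rep_carrier[OF \<tau> inv_closed[OF h]] rep_carrier[OF \<tau> h]
    have "\<tau> (inv (h \<otimes> g)) * \<tau> h = \<tau> (inv g)"
      using g h by (simp flip: rep_mult[OF \<tau>] add: inv_mult_group m_assoc)
    moreover have "?F (h \<otimes> g) * \<tau> h = \<sigma> (h \<otimes> g) * E * (\<tau> (inv (h \<otimes> g)) * \<tau> h)"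
      using car g h rep_carrier[OF \<sigma>, of "h \<otimes> g"] rep_carrier[OF \<tau>, of "inv (h \<otimes> g)"]
      by (intro assoc_mult_mat) auto
    ultimately have "?F (h \<otimes> g) * \<tau> h = \<sigma> (h \<otimes> g) * E * \<tau> (inv g)" by simp
    then show "\<sigma> h * ?F g = ?F (h \<otimes> g) * \<tau> h"
      using car g h by (simp add: rep_mult[OF \<sigma>] assoc_mult_mat[of _ n n _ m _ m]
          assoc_mult_mat[of _ n n _ n _ m])
  qed
  also have "\<dots> = mat_sum n m (\<lambda>g. ?F g * \<tau> h) (carrier G)"
    by (rule mat_sum_translate[OF h])
  also have "\<dots> = T * \<tau> h"
    unfolding T by (rule mat_sum_mult[OF rep_carrier[OF \<tau> h] F, symmetric])
  finally show ?thesis ..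
qed

text \<open>The sum is the entry \<open>(a, d)\<close> of an averaged intertwiner between
  non-isomorphic irreducibles.\<close>

lemma matrix_coeffs_orthogonal:
  assumes \<sigma>: "irreducible_representation G n \<sigma>" and \<tau>: "irreducible_representation G m \<tau>"
    and iso: "\<not> rep_iso G \<tau> \<sigma>" and ab: "a < n" "b < n" and cd: "c < m" "d < m"
  shows "(\<Sum>g\<in>carrier G. \<sigma> g $$ (a, b) * \<tau> (inv g) $$ (c, d)) = 0"
proof -
  let ?T = "mat n m (\<lambda>(i, j). \<Sum>g\<in>carrier G. \<sigma> g $$ (i, b) * \<tau> (inv g) $$ (c, j))"
  have "?T = 0\<^sub>m n m"
    by (rule schur_not_iso[OF \<tau> \<sigma> mat_carrier
          average_intertwines[OF irrep_rep[OF \<sigma>] irrep_rep[OF \<tau>] ab(2) cd(1)] iso])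
  hence "?T $$ (a, d) = 0" using ab cd by simp
  then show ?thesis using ab cd by simp
qed

text \<open>The form is not divided by the group order, so multiplicities later come out multiplied
  by \<open>card (carrier G)\<close>.\<close>

definition cinner :: "('a \<Rightarrow> complex) \<Rightarrow> ('a \<Rightarrow> complex) \<Rightarrow> complex" where
  "cinner \<phi> \<psi> = (\<Sum>g\<in>carrier G. \<phi> g * \<psi> (inv g))"

lemma cinner_character:
  assumes "representation G n \<sigma>" "representation G m \<tau>"
  shows "cinner (character \<sigma>) (character \<tau>) =
    (\<Sum>a<n. \<Sum>c<m. \<Sum>g\<in>carrier G. \<sigma> g $$ (a, a) * \<tau> (inv g) $$ (c, c))"
proof -
  have "cinner (character \<sigma>) (character \<tau>) =
      (\<Sum>g\<in>carrier G. \<Sum>a<n. \<Sum>c<m. \<sigma> g $$ (a, a) * \<tau> (inv g) $$ (c, c))"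
    unfolding cinner_def
  proof (rule sum.cong)
    fix g assume g: "g \<in> carrier G"
    have "dim_row (\<sigma> g) = n" "dim_row (\<tau> (inv g)) = m"
      using rep_carrier[OF assms(1) g] rep_carrier[OF assms(2) inv_closed[OF g]] by auto
    then show "character \<sigma> g * character \<tau> (inv g) = (\<Sum>a<n. \<Sum>c<m. \<sigma> g $$ (a, a) * \<tau> (inv g) $$ (c, c))"
      by (simp add: character_def mat_trace_def sum_product)
  qed simp
  also have "\<dots> = (\<Sum>a<n. \<Sum>g\<in>carrier G. \<Sum>c<m. \<sigma> g $$ (a, a) * \<tau> (inv g) $$ (c, c))"
    by (rule sum.swap)
  also have "\<dots> = (\<Sum>a<n. \<Sum>c<m. \<Sum>g\<in>carrier G. \<sigma> g $$ (a, a) * \<tau> (inv g) $$ (c, c))"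
    by (intro sum.cong sum.swap) auto
  finally show ?thesis .
qed

lemma cinner_not_iso:
  assumes "irreducible_representation G n \<sigma>" "irreducible_representation G m \<tau>" "\<not> rep_iso G \<tau> \<sigma>"
  shows "cinner (character \<sigma>) (character \<tau>) = 0"
  unfolding cinner_character[OF irrep_rep[OF assms(1)] irrep_rep[OF assms(2)]]
  using matrix_coeffs_orthogonal[OF assms] by simp

lemma cinner_self:
  assumes \<sigma>: "irreducible_representation G n \<sigma>"
  shows "cinner (character \<sigma>) (character \<sigma>) = of_nat (card (carrier G))"
proof -
  note rep = irrep_rep[OF \<sigma>]
  have n0: "n \<noteq> 0" using \<sigma> unfolding irreducible_representation_def by blast
  let ?S = "\<lambda>a b c d. \<Sum>g\<in>carrier G. \<sigma> g $$ (a, b) * \<sigma> (inv g) $$ (c, d)"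
  let ?C = "of_nat (card (carrier G)) :: complex"
  have S: "?S a b c d = (if a = d \<and> b = c then ?C / of_nat n else 0)"
    if abcd: "a < n" "b < n" "c < n" "d < n" for a b c d
  proof -
    let ?T = "mat n n (\<lambda>(i, j). ?S i b c j)"
    obtain k where k: "?T = k \<cdot>\<^sub>m 1\<^sub>m n"
      by (rule schur_scalar[OF \<sigma> mat_carrier average_intertwines[OF rep rep abcd(2,3)]])
    have Sk: "?S i b c j = (if i = j then k else 0)" if "i < n" "j < n" for i j
      using arg_cong[OF k, of "\<lambda>M. M $$ (i, j)"] that by (auto split: if_splits)
    \<comment> \<open>The scalar \<open>k\<close> is found by taking the trace: summing over the
      outer index assembles the entry \<open>(c, b)\<close> of
      \<open>\<sigma> (inv g) * \<sigma> g\<close>, an identity matrix.\<close>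
    have "of_nat n * k = (\<Sum>i<n. ?S i b c i)" using Sk by simp
    also have "\<dots> = (\<Sum>g\<in>carrier G. \<Sum>i<n. \<sigma> (inv g) $$ (c, i) * \<sigma> g $$ (i, b))"
      by (subst sum.swap) (simp add: mult.commute)
    also have "\<dots> = (\<Sum>g\<in>carrier G. (\<sigma> (inv g) * \<sigma> g) $$ (c, b))"
    proof (rule sum.cong)
      fix g assume g: "g \<in> carrier G"
      show "(\<Sum>i<n. \<sigma> (inv g) $$ (c, i) * \<sigma> g $$ (i, b)) = (\<sigma> (inv g) * \<sigma> g) $$ (c, b)"
        using rep_carrier[OF rep g] rep_carrier[OF rep inv_closed[OF g]] abcd
        by (simp add: scalar_prod_def lessThan_atLeast0)
    qed simp
    also have "\<dots> = (\<Sum>g\<in>carrier G. if b = c then 1 else 0)"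
      using abcd by (intro sum.cong) (auto simp: rep_inv[OF rep])
    also have "\<dots> = (if b = c then ?C else 0)" by simp
    finally have "k = (if b = c then ?C / of_nat n else 0)"
      using n0 by (auto simp: field_simps)
    then show ?thesis using Sk[OF abcd(1,4)] by simp
  qed
  have "cinner (character \<sigma>) (character \<sigma>) = (\<Sum>a<n. \<Sum>c<n. ?S a a c c)"
    by (rule cinner_character[OF rep rep])
  also have "\<dots> = (\<Sum>a<n. \<Sum>c<n. if c = a then ?C / of_nat n else 0)"
    by (intro sum.cong) (auto simp: S)
  also have "\<dots> = ?C" using n0 by simp
  finally show ?thesis .
qed

end

section \<open>Complete reducibility\<close>

lemma four_block_mat_inj:
  assumes "A \<in> carrier_mat a b" "B \<in> carrier_mat a d" "C \<in> carrier_mat c b" "D \<in> carrier_mat c d"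
    and "A' \<in> carrier_mat a b" "B' \<in> carrier_mat a d" "C' \<in> carrier_mat c b" "D' \<in> carrier_mat c d"
    and eq: "four_block_mat A B C D = four_block_mat A' B' C' D'"
  shows "A = A'" "B = B'" "D = D'"
proof -
  have e: "four_block_mat A B C D $$ (i, j) = four_block_mat A' B' C' D' $$ (i, j)" for i j
    using eq by simp
  show "A = A'"
  proof (rule eq_matI)
    fix i j assume "i < dim_row A'" "j < dim_col A'"
    then show "A $$ (i, j) = A' $$ (i, j)" using e[of i j] assms(1-8) by auto
  qed (use assms(1-8) in auto)
  show "B = B'"
  proof (rule eq_matI)
    fix i j assume "i < dim_row B'" "j < dim_col B'"
    then show "B $$ (i, j) = B' $$ (i, j)" using e[of i "j + b"] assms(1-8) by auto
  qed (use assms(1-8) in auto)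
  show "D = D'"
  proof (rule eq_matI)
    fix i j assume "i < dim_row D'" "j < dim_col D'"
    then show "D $$ (i, j) = D' $$ (i, j)" using e[of "i + a" "j + b"] assms(1-8) by auto
  qed (use assms(1-8) in auto)
qed

context finite_group begin

text \<open>All three claims are read off by comparing blocks in
  \<open>\<rho> (g \<otimes> h) = \<rho> g * \<rho> h\<close>; the upper right corner gives the
  cocycle identity for \<open>B\<close>.\<close>

lemma block_triangular_reps:
  assumes \<rho>: "representation G (a + d) \<rho>"
    and c: "\<And>g. g \<in> carrier G \<Longrightarrow> A g \<in> carrier_mat a a" "\<And>g. g \<in> carrier G \<Longrightarrow> B g \<in> carrier_mat a d"
      "\<And>g. g \<in> carrier G \<Longrightarrow> D g \<in> carrier_mat d d"
    and eq: "\<And>g. g \<in> carrier G \<Longrightarrow> \<rho> g = four_block_mat (A g) (B g) (0\<^sub>m d a) (D g)"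
  shows "representation G a A" "representation G d D"
    and "\<And>g h. g \<in> carrier G \<Longrightarrow> h \<in> carrier G \<Longrightarrow> B (g \<otimes> h) = A g * B h + B g * D h"
proof -
  have *: "A (g \<otimes> h) = A g * A h" "B (g \<otimes> h) = A g * B h + B g * D h" "D (g \<otimes> h) = D g * D h"
    if g: "g \<in> carrier G" and h: "h \<in> carrier G" for g h
  proof -
    note car = c[OF g] c[OF h] c[OF m_closed[OF g h]]
    have "four_block_mat (A (g \<otimes> h)) (B (g \<otimes> h)) (0\<^sub>m d a) (D (g \<otimes> h)) = \<rho> g * \<rho> h"
      using eq[OF m_closed[OF g h]] rep_mult[OF \<rho> g h] by simp
    also have "\<dots> = four_block_mat (A g * A h + B g * 0\<^sub>m d a) (A g * B h + B g * D h)
        (0\<^sub>m d a * A h + D g * 0\<^sub>m d a) (0\<^sub>m d a * B h + D g * D h)"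
      unfolding eq[OF g] eq[OF h] using car by (intro mult_four_block_mat) auto
    finally have e: "four_block_mat (A (g \<otimes> h)) (B (g \<otimes> h)) (0\<^sub>m d a) (D (g \<otimes> h)) = \<dots>" .
    have "A (g \<otimes> h) = A g * A h + B g * 0\<^sub>m d a" "B (g \<otimes> h) = A g * B h + B g * D h"
      "D (g \<otimes> h) = 0\<^sub>m d a * B h + D g * D h"
      by (rule four_block_mat_inj[OF _ _ _ _ _ _ _ _ e, of a a d d]; use car in auto)+
    then show "A (g \<otimes> h) = A g * A h" "B (g \<otimes> h) = A g * B h + B g * D h" "D (g \<otimes> h) = D g * D h"
      using car by auto
  qed
  have "four_block_mat (A \<one>) (B \<one>) (0\<^sub>m d a) (D \<one>) = four_block_mat (1\<^sub>m a) (0\<^sub>m a d) (0\<^sub>m d a) (1\<^sub>m d)"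
    using eq[OF one_closed] rep_one[OF \<rho>] by simp
  note e = this
  have "A \<one> = 1\<^sub>m a" "D \<one> = 1\<^sub>m d"
    by (rule four_block_mat_inj[OF _ _ _ _ _ _ _ _ e, of a a d d]; use c[OF one_closed] in auto)+
  with * c show "representation G a A" "representation G d D" by (auto intro: representationI)
  show "\<And>g h. g \<in> carrier G \<Longrightarrow> h \<in> carrier G \<Longrightarrow> B (g \<otimes> h) = A g * B h + B g * D h"
    by (rule *)
qed

text \<open>The off-diagonal block is a coboundary: \<open>X = |G|\<^sup>-\<^sup>1 \<Sum>\<^sub>h B(h) D(h)\<^sup>-\<^sup>1\<close> satisfies
  \<open>A(g) X + B(g) = X D(g)\<close>, so conjugation by the unipotent matrix with corner \<open>X\<close>
  removes it.\<close>

lemma block_triangular_splits: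
  assumes \<rho>: "representation G (a + d) \<rho>"
    and c: "\<And>g. g \<in> carrier G \<Longrightarrow> A g \<in> carrier_mat a a" "\<And>g. g \<in> carrier G \<Longrightarrow> B g \<in> carrier_mat a d"
      "\<And>g. g \<in> carrier G \<Longrightarrow> D g \<in> carrier_mat d d"
    and eq: "\<And>g. g \<in> carrier G \<Longrightarrow> \<rho> g = four_block_mat (A g) (B g) (0\<^sub>m d a) (D g)"
  shows "rep_iso G (block_sum_rep A D) \<rho>"
proof -
  have AD: "representation G a A" "representation G d D"
    "\<And>g h. g \<in> carrier G \<Longrightarrow> h \<in> carrier G \<Longrightarrow> B (g \<otimes> h) = A g * B h + B g * D h"
    using block_triangular_reps[of a d \<rho> A B D] assms by blast+
  define S where "S = mat_sum a d (\<lambda>h. B h * D (inv h)) (carrier G)"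
  define k where "k = (of_nat (card (carrier G)) :: complex)"
  have k0: "k \<noteq> 0" using card_carrier_pos by (simp add: k_def)
  define X where "X = inverse k \<cdot>\<^sub>m S"
  have S: "S \<in> carrier_mat a d" by (simp add: S_def)
  have X: "X \<in> carrier_mat a d" using S by (simp add: X_def)
  have BD: "B h * D (inv h) \<in> carrier_mat a d" if "h \<in> carrier G" for h
    using c(2)[OF that] c(3)[OF inv_closed[OF that]] by simp
  have coboundary: "A g * X + B g = X * D g" if g: "g \<in> carrier G" for g
  proof -
    note cg = c[OF g]
    have "S * D g = mat_sum a d (\<lambda>h. B h * D (inv h) * D g) (carrier G)"
      unfolding S_def by (rule mat_sum_mult[OF cg(3) BD])
    \<comment> \<open>After translation by \<open>g\<close> the cocycle identity turns each summand
      into \<open>A g\<close> times the original one plus \<open>B g\<close>. The latter does not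
      depend on \<open>h\<close> and is therefore counted \<open>k\<close> times.\<close>
    also have "\<dots> = mat_sum a d (\<lambda>h. B (g \<otimes> h) * D (inv (g \<otimes> h)) * D g) (carrier G)"
      by (rule mat_sum_translate[OF g, symmetric])
    also have "\<dots> = mat_sum a d (\<lambda>h. A g * (B h * D (inv h)) + B g) (carrier G)"
    proof (rule mat_sum_cong)
      fix h assume h: "h \<in> carrier G"
      note car = cg c[OF h] c[OF inv_closed[OF h]] c[OF inv_closed[OF m_closed[OF g h]]]
      have "B (g \<otimes> h) * D (inv (g \<otimes> h)) * D g = B (g \<otimes> h) * (D (inv (g \<otimes> h)) * D g)"
        using car c[OF m_closed[OF g h]] by (intro assoc_mult_mat) auto
      also have "D (inv (g \<otimes> h)) * D g = D (inv h)"
        using g h by (simp flip: rep_mult[OF AD(2)] add: inv_mult_group m_assoc)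
      also have "B (g \<otimes> h) * D (inv h) = A g * B h * D (inv h) + B g * D h * D (inv h)"
        unfolding AD(3)[OF g h] using car by (intro add_mult_distrib_mat) auto
      also have "A g * B h * D (inv h) = A g * (B h * D (inv h))"
        using car by (intro assoc_mult_mat) auto
      also have "B g * D h * D (inv h) = B g * (D h * D (inv h))"
        using car by (intro assoc_mult_mat) auto
      also have "\<dots> = B g" using car rep_inv[OF AD(2) h] by simp
      finally show "B (g \<otimes> h) * D (inv (g \<otimes> h)) * D g = A g * (B h * D (inv h)) + B g" .
    qed
    also have "\<dots> = mat_sum a d (\<lambda>h. A g * (B h * D (inv h))) (carrier G) + k \<cdot>\<^sub>m B g"
      using cg(2) by (intro eq_matI) (auto simp: mat_sum_def k_def sum.distrib)
    also have "mat_sum a d (\<lambda>h. A g * (B h * D (inv h))) (carrier G) = A g * S"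
      unfolding S_def by (rule mult_mat_sum[OF cg(1) BD, symmetric])
    finally have *: "S * D g = A g * S + k \<cdot>\<^sub>m B g" .
    have "X * D g = inverse k \<cdot>\<^sub>m (A g * S + k \<cdot>\<^sub>m B g)"
      unfolding X_def *[symmetric] using S cg by (intro mult_smult_assoc_mat) auto
    also have "\<dots> = A g * X + B g"
      unfolding X_def using S cg k0
      by (subst mult_smult_distrib[of _ a a _ d]) (auto intro!: eq_matI simp: field_simps)
    finally show ?thesis ..
  qed
  let ?R = "\<lambda>X. four_block_mat (1\<^sub>m a) X (0\<^sub>m d a) (1\<^sub>m d)"
  note m = mult_four_block_mat[of _ a a _ d _ d _ _ a _ d]
  have inverses: "X + - X = 0\<^sub>m a d" "- X + X = 0\<^sub>m a d" "- 0\<^sub>m d d = (0\<^sub>m d d :: complex mat)"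
    using X by (auto intro!: eq_matI)
  show ?thesis
  proof (rule rep_isoI[OF representation_block_sum[OF AD(1,2)] \<rho>])
    show "?R X \<in> carrier_mat (a + d) (a + d)" "?R (- X) \<in> carrier_mat (a + d) (a + d)" by auto
    show "?R X * ?R (- X) = 1\<^sub>m (a + d)" "?R (- X) * ?R X = 1\<^sub>m (a + d)"
      using X inverses by (simp_all add: m)
    fix g assume g: "g \<in> carrier G"
    note cg = c[OF g]
    have "?R X * block_sum_rep A D g = four_block_mat (A g) (X * D g) (0\<^sub>m d a) (D g)"
      using X cg g AD by (simp add: block_sum_rep_apply m)
    also have "\<dots> = \<rho> g * ?R X"
      using X cg unfolding eq[OF g] coboundary[OF g, symmetric] by (simp add: m)
    finally show "?R X * block_sum_rep A D g = \<rho> g * ?R X" .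
  qed
qed

text \<open>In a basis adapted to an invariant subspace all matrices are block triangular, and then
  the corner can be removed. The strict bounds on \<open>a\<close> and \<open>d\<close> serve the
  induction on the dimension.\<close>

lemma reducible_splits:
  assumes \<rho>: "representation G n \<rho>" and n: "n \<noteq> 0" and "\<not> irreducible_representation G n \<rho>"
  obtains a d \<alpha> \<delta> where "a < n" "d < n" "representation G a \<alpha>" "representation G d \<delta>"
    "rep_iso G \<rho> (block_sum_rep \<alpha> \<delta>)"
proof -
  from assms obtain W where W: "VectorSpace.subspace class_ring W (module_vec TYPE(complex) n)"
    "W \<noteq> {0\<^sub>v n}" "W \<noteq> carrier_vec n" and inv: "\<And>g w. g \<in> carrier G \<Longrightarrow> w \<in> W \<Longrightarrow> \<rho> g *\<^sub>v w \<in> W"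
    unfolding irreducible_representation_def by blast
  from adapted_basis[OF W] obtain k P Q where k: "0 < k" "k < n" and P: "P \<in> carrier_mat n n"
    and Q: "Q \<in> carrier_mat n n" and PQ: "P * Q = 1\<^sub>m n" and QP: "Q * P = 1\<^sub>m n"
    and PW: "\<And>j. j < k \<Longrightarrow> col P j \<in> W"
    and QW: "\<And>w i. w \<in> W \<Longrightarrow> k \<le> i \<Longrightarrow> i < n \<Longrightarrow> (Q *\<^sub>v w) $ i = 0" by metis
  define \<rho>' where "\<rho>' = (\<lambda>g. Q * (\<rho> g * P))"
  have car: "\<rho>' g \<in> carrier_mat n n" if "g \<in> carrier G" for g
    using rep_carrier[OF \<rho> that] P Q by (simp add: \<rho>'_def)
  have P\<rho>': "P * \<rho>' g = \<rho> g * P" if g: "g \<in> carrier G" for g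
  proof -
    have "P * \<rho>' g = P * Q * (\<rho> g * P)"
      unfolding \<rho>'_def using rep_carrier[OF \<rho> g] P Q by (intro assoc_mult_mat[symmetric]) auto
    then show ?thesis using PQ rep_carrier[OF \<rho> g] P by simp
  qed
  have \<rho>': "representation G n \<rho>'"
  proof (rule representationI)
    show "\<rho>' \<one> = 1\<^sub>m n" using QP P by (simp add: \<rho>'_def rep_one[OF \<rho>])
    fix g h assume g: "g \<in> carrier G" and h: "h \<in> carrier G"
    note c = rep_carrier[OF \<rho> g] rep_carrier[OF \<rho> h] P Q car[OF g] car[OF h]
    have "\<rho>' g * \<rho>' h = Q * (\<rho> g * P * \<rho>' h)"
      unfolding \<rho>'_def[of, THEN fun_cong, of g] using c by (intro assoc_mult_mat) auto
    also have "\<rho> g * P * \<rho>' h = \<rho> g * (P * \<rho>' h)" using c by (intro assoc_mult_mat) auto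
    also have "\<dots> = \<rho> g * \<rho> h * P" unfolding P\<rho>'[OF h] using c by (intro assoc_mult_mat[symmetric]) auto
    finally show "\<rho>' (g \<otimes> h) = \<rho>' g * \<rho>' h" by (simp add: \<rho>'_def rep_mult[OF \<rho> g h])
  qed (rule car)
  have iso: "rep_iso G \<rho>' \<rho>"
    by (rule rep_isoI[OF \<rho>' \<rho> P Q PQ QP P\<rho>'])
  \<comment> \<open>Column \<open>j\<close> of \<open>P\<close> lies in \<open>W\<close>, and so
    does its image under \<open>\<rho> g\<close>; the coordinates of that image from
    \<open>k\<close> on vanish.\<close>
  have zero: "\<rho>' g $$ (i, j) = 0" if g: "g \<in> carrier G" and ij: "k \<le> i" "i < n" "j < k" for g i j
  proof -
    note c = rep_carrier[OF \<rho> g] P Q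
    have "\<rho>' g $$ (i, j) = (Q *\<^sub>v col (\<rho> g * P) j) $ i"
      unfolding \<rho>'_def using c ij k by simp
    also have "col (\<rho> g * P) j = \<rho> g *\<^sub>v col P j" using c ij k by (intro col_mult2[of _ n n _ n]) auto
    finally show ?thesis using QW[OF inv[OF g PW]] ij by simp
  qed
  define d where "d = n - k"
  have n': "n = k + d" using k by (simp add: d_def)
  define A where "A = (\<lambda>g. mat k k (\<lambda>(i, j). \<rho>' g $$ (i, j)))"
  define B where "B = (\<lambda>g. mat k d (\<lambda>(i, j). \<rho>' g $$ (i, j + k)))"
  define D where "D = (\<lambda>g. mat d d (\<lambda>(i, j). \<rho>' g $$ (i + k, j + k)))"
  have eq: "\<rho>' g = four_block_mat (A g) (B g) (0\<^sub>m d k) (D g)" if g: "g \<in> carrier G" for g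
    using car[OF g] zero[OF g] by (intro eq_matI) (auto simp: A_def B_def D_def n')
  have cc: "A g \<in> carrier_mat k k" "B g \<in> carrier_mat k d" "D g \<in> carrier_mat d d" for g
    by (auto simp: A_def B_def D_def)
  note s = \<rho>'[unfolded n'] cc eq
  show thesis
  proof (rule that)
    show "rep_iso G \<rho> (block_sum_rep A D)"
      using block_triangular_splits[OF s] iso by (blast intro: rep_iso_sym rep_iso_trans)
  qed (use block_triangular_reps[OF s] k in \<open>auto simp: d_def\<close>)
qed

end

section \<open>Decomposition into a complete list of irreducibles, and multiplicities\<close>

locale irreps = finite_group +
  fixes \<sigma>s :: "('a \<Rightarrow> complex mat) list"
  assumes complete: "complete_irreps G \<sigma>s"
begin

abbreviation "r \<equiv> length \<sigma>s"

lemma irrep: "i < r \<Longrightarrow> \<exists>n. irreducible_representation G n (\<sigma>s ! i)"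
  using complete unfolding complete_irreps_def by simp

lemma set_irreps_rep: "\<tau> \<in> set \<sigma>s \<Longrightarrow> \<exists>n. representation G n \<tau>"
  using complete unfolding complete_irreps_def by (blast intro: irrep_rep)

lemma not_iso: "i < r \<Longrightarrow> j < r \<Longrightarrow> i \<noteq> j \<Longrightarrow> \<not> rep_iso G (\<sigma>s ! i) (\<sigma>s ! j)"
  using complete unfolding complete_irreps_def by blast

lemma distinct_irreps: "distinct \<sigma>s"
proof -
  have "\<sigma>s ! i \<noteq> \<sigma>s ! j" if "i < r" "j < r" "i \<noteq> j" for i j
    using not_iso[OF that] rep_iso_refl set_irreps_rep[OF nth_mem[OF that(1)]] by auto
  then show ?thesis by (simp add: distinct_conv_nth)
qed

text \<open>Maschke's theorem, by strong induction on the dimension. Dimension zero is a case of its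
  own, because such a representation does not count as irreducible; it is the empty direct
  sum.\<close>

theorem complete_reducibility:
  "representation G n \<rho> \<Longrightarrow> \<exists>\<tau>s. set \<tau>s \<subseteq> set \<sigma>s \<and> rep_iso G \<rho> (direct_sum_rep \<tau>s)"
proof (induction n arbitrary: \<rho> rule: less_induct)
  case (less n)
  consider "n = 0" | "irreducible_representation G n \<rho>" | "n \<noteq> 0" "\<not> irreducible_representation G n \<rho>"
    by blast
  then show ?case
  proof cases
    case 1
    have "rep_iso G \<rho> (direct_sum_rep [])"
    proof (rule rep_isoI[of 0 _ _ "1\<^sub>m 0" "1\<^sub>m 0"])
      show "representation G 0 \<rho>" using less.prems 1 by simp
      show "representation G 0 (direct_sum_rep [])"
        by (rule representationI) (auto simp: direct_sum_rep_Nil)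
      show "1\<^sub>m 0 * \<rho> g = direct_sum_rep [] g * 1\<^sub>m 0" if "g \<in> carrier G" for g
        using rep_carrier[OF less.prems that] 1 by (intro eq_matI) (auto simp: direct_sum_rep_Nil)
    qed auto
    then show ?thesis by (intro exI[of _ "[]"]) simp
  next
    case 2
    then obtain \<sigma> where "\<sigma> \<in> set \<sigma>s" "rep_iso G \<rho> \<sigma>"
      using complete unfolding complete_irreps_def by blast
    then show ?thesis by (intro exI[of _ "[\<sigma>]"]) (simp add: direct_sum_rep_single)
  next
    case 3
    obtain a d \<alpha> \<delta> where ad: "a < n" "d < n" "representation G a \<alpha>" "representation G d \<delta>"
      and iso: "rep_iso G \<rho> (block_sum_rep \<alpha> \<delta>)"
      using reducible_splits[OF less.prems 3] .
    obtain as where as: "set as \<subseteq> set \<sigma>s" "rep_iso G \<alpha> (direct_sum_rep as)"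
      using less.IH[OF ad(1,3)] by blast
    obtain ds where ds: "set ds \<subseteq> set \<sigma>s" "rep_iso G \<delta> (direct_sum_rep ds)"
      using less.IH[OF ad(2,4)] by blast
    have "rep_iso G \<rho> (direct_sum_rep (as @ ds))"
      unfolding direct_sum_rep_append
      by (rule rep_iso_trans[OF iso rep_iso_block_sum[OF as(2) ds(2)]])
    then show ?thesis using as ds by (intro exI[of _ "as @ ds"]) simp
  qed
qed

text \<open>The same expression as in \<open>mckay_matrix\<close>, with a row of the matrix
  abstracted to a function, so that the defining property there can be restated by mere
  unfolding.\<close>

definition with_mults :: "(nat \<Rightarrow> nat) \<Rightarrow> ('a \<Rightarrow> complex mat) list" where
  "with_mults m = concat (map (\<lambda>j. replicate (m j) (\<sigma>s ! j)) [0..<r])"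

lemma set_with_mults: "set (with_mults m) = {\<sigma>s ! j |j. j < r \<and> m j \<noteq> 0}"
  by (auto simp: with_mults_def)

lemma set_with_mults_subset: "set (with_mults m) \<subseteq> set \<sigma>s"
  by (auto simp: set_with_mults)

lemma count_with_mults:
  assumes "i < r"
  shows "count (mset (with_mults m)) (\<sigma>s ! i) = m i"
proof -
  have "count (mset (with_mults m)) (\<sigma>s ! i) = (\<Sum>j<r. count (mset (replicate (m j) (\<sigma>s ! j))) (\<sigma>s ! i))"
    by (simp add: with_mults_def mset_concat comp_def interv_sum_list_conv_sum_set_nat atLeast0LessThan
        count_sum)
  also have "\<dots> = (\<Sum>j<r. if j = i then m j else 0)"
    using assms distinct_irreps by (intro sum.cong) (auto simp: nth_eq_iff_index_eq)
  finally show ?thesis using assms by simp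
qed

lemma decomposition:
  assumes "representation G n \<rho>"
  obtains m where "rep_iso G \<rho> (direct_sum_rep (with_mults m))"
proof -
  obtain \<tau>s where \<tau>s: "set \<tau>s \<subseteq> set \<sigma>s" "rep_iso G \<rho> (direct_sum_rep \<tau>s)"
    using complete_reducibility[OF assms] by blast
  define m where "m = (\<lambda>j. count (mset \<tau>s) (\<sigma>s ! j))"
  have "mset \<tau>s = mset (with_mults m)"
  proof (rule multiset_eqI)
    fix \<tau>
    show "count (mset \<tau>s) \<tau> = count (mset (with_mults m)) \<tau>"
    proof (cases "\<tau> \<in> set \<sigma>s")
      case True
      then obtain j where "j < r" "\<tau> = \<sigma>s ! j" by (auto simp: in_set_conv_nth)
      then show ?thesis by (simp add: count_with_mults m_def)
    next
      case False
      hence "\<tau> \<notin> set \<tau>s" "\<tau> \<notin> set (with_mults m)" using \<tau>s set_with_mults_subset by blast+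
      then show ?thesis by (metis count_mset_0_iff)
    qed
  qed
  from rep_iso_direct_sum_mset[OF this] \<tau>s set_irreps_rep
  have "rep_iso G (direct_sum_rep \<tau>s) (direct_sum_rep (with_mults m))" by blast
  then show thesis using that \<tau>s rep_iso_trans by blast
qed

definition \<chi> :: "nat \<Rightarrow> 'a \<Rightarrow> complex" where "\<chi> i = character (\<sigma>s ! i)"

lemma cinner_\<chi>:
  assumes "i < r" "j < r"
  shows "cinner (\<chi> i) (\<chi> j) = (if i = j then of_nat (card (carrier G)) else 0)"
proof -
  obtain n m where "irreducible_representation G n (\<sigma>s ! i)" "irreducible_representation G m (\<sigma>s ! j)"
    using irrep assms by blast
  then show ?thesis
    using not_iso[of j i] assms cinner_self cinner_not_iso unfolding \<chi>_def by auto
qed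

lemma character_with_mults:
  assumes "rep_iso G \<rho> (direct_sum_rep (with_mults m))" "g \<in> carrier G"
  shows "character \<rho> g = (\<Sum>j<r. of_nat (m j) * \<chi> j g)"
proof -
  have "character \<rho> g = (\<Sum>\<tau>\<leftarrow>with_mults m. character \<tau> g)"
    using character_iso[OF assms] character_direct_sum[of "with_mults m" g] assms
      set_with_mults_subset set_irreps_rep by auto
  also have "\<dots> = (\<Sum>j\<leftarrow>[0..<r]. of_nat (m j) * \<chi> j g)"
  proof -
    have "(\<Sum>\<tau>\<leftarrow>concat (map (\<lambda>j. replicate (m j) (\<sigma>s ! j)) js). character \<tau> g) =
        (\<Sum>j\<leftarrow>js. of_nat (m j) * \<chi> j g)" for js
      by (induction js) (simp_all add: sum_list_replicate \<chi>_def)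
    then show ?thesis unfolding with_mults_def .
  qed
  finally show ?thesis by (simp add: interv_sum_list_conv_sum_set_nat atLeast0LessThan)
qed

text \<open>Orthogonality isolates one multiplicity, so the character determines all of them; this
  is the source of uniqueness of the McKay matrix.\<close>

lemma cinner_with_mults:
  assumes "rep_iso G \<rho> (direct_sum_rep (with_mults m))" "i < r"
  shows "cinner (character \<rho>) (\<chi> i) = of_nat (m i) * of_nat (card (carrier G))"
proof -
  have "cinner (character \<rho>) (\<chi> i) = (\<Sum>g\<in>carrier G. \<Sum>j<r. of_nat (m j) * (\<chi> j g * \<chi> i (inv g)))"
    unfolding cinner_def using character_with_mults[OF assms(1)]
    by (intro sum.cong) (simp_all add: sum_distrib_right mult.assoc)
  also have "\<dots> = (\<Sum>j<r. of_nat (m j) * cinner (\<chi> j) (\<chi> i))"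
    by (subst sum.swap) (simp add: cinner_def sum_distrib_left)
  also have "\<dots> = (\<Sum>j<r. if j = i then of_nat (m j) * of_nat (card (carrier G)) else 0)"
    using assms by (intro sum.cong) (auto simp: cinner_\<chi>)
  finally show ?thesis using assms by simp
qed

end

section \<open>Matrix coefficients and the McKay matrix\<close>

context group begin

text \<open>The linear span of the matrix coefficients of the members of \<open>R\<close>. The rules
  look at functions on \<open>carrier G\<close> only, as representations are arbitrary elsewhere;
  \<open>representation G n \<tau>\<close> fixes the range of the indices.\<close>

inductive_set coeff_span :: "('a \<Rightarrow> complex mat) set \<Rightarrow> ('a \<Rightarrow> complex) set" for R where
  entry: "\<lbrakk>\<tau> \<in> R; representation G n \<tau>; a < n; b < n; \<forall>g\<in>carrier G. \<phi> g = \<tau> g $$ (a, b)\<rbrakk>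
    \<Longrightarrow> \<phi> \<in> coeff_span R"
| zero: "(\<forall>g\<in>carrier G. \<phi> g = 0) \<Longrightarrow> \<phi> \<in> coeff_span R"
| add: "\<lbrakk>\<phi> \<in> coeff_span R; \<psi> \<in> coeff_span R; \<forall>g\<in>carrier G. \<theta> g = \<phi> g + \<psi> g\<rbrakk>
    \<Longrightarrow> \<theta> \<in> coeff_span R"
| scale: "\<lbrakk>\<phi> \<in> coeff_span R; \<forall>g\<in>carrier G. \<theta> g = c * \<phi> g\<rbrakk> \<Longrightarrow> \<theta> \<in> coeff_span R"

lemma coeff_span_cong:
  assumes "\<phi> \<in> coeff_span R" "\<And>g. g \<in> carrier G \<Longrightarrow> \<psi> g = \<phi> g"
  shows "\<psi> \<in> coeff_span R"
  by (rule coeff_span.scale[OF assms(1), of _ 1]) (simp add: assms(2))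

lemma coeff_span_sum:
  assumes "finite A" "\<And>x. x \<in> A \<Longrightarrow> F x \<in> coeff_span R"
  shows "(\<lambda>g. \<Sum>x\<in>A. F x g) \<in> coeff_span R"
  using assms
proof (induction A rule: finite_induct)
  case empty
  then show ?case by (simp add: coeff_span.zero)
next
  case (insert x A)
  have "F x \<in> coeff_span R" "(\<lambda>g. \<Sum>x\<in>A. F x g) \<in> coeff_span R"
    using insert.prems insert.IH by blast+
  then show ?case by (rule coeff_span.add) (simp add: insert.hyps)
qed

lemma coeff_span_subset:
  assumes "\<And>\<tau> n a b. \<tau> \<in> R \<Longrightarrow> representation G n \<tau> \<Longrightarrow> a < n \<Longrightarrow> b < n \<Longrightarrow> (\<lambda>g. \<tau> g $$ (a, b)) \<in> coeff_span R'"
  shows "coeff_span R \<subseteq> coeff_span R'"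
proof
  fix \<phi> assume "\<phi> \<in> coeff_span R"
  then show "\<phi> \<in> coeff_span R'"
  proof induction
    case (entry \<tau> n a b \<phi>)
    show ?case by (rule coeff_span_cong[OF assms[OF entry(1-4)]]) (simp add: entry(5))
  next
    case (zero \<phi>)
    then show ?case by (rule coeff_span.zero)
  next
    case (add \<phi> \<psi> \<theta>)
    show ?case by (rule coeff_span.add[OF add.IH add.hyps(3)])
  next
    case (scale \<phi> \<theta> c)
    show ?case by (rule coeff_span.scale[OF scale.IH scale.hyps(2)])
  qed
qed

lemma coeff_span_mono: "R \<subseteq> R' \<Longrightarrow> coeff_span R \<subseteq> coeff_span R'"
  by (intro coeff_span_subset) (blast intro: coeff_span.entry)

text \<open>The entries of \<open>Q * \<sigma> g * P\<close> are combinations of the entries of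
  \<open>\<sigma> g\<close> whose coefficients do not depend on \<open>g\<close>.\<close>

lemma coeff_span_iso:
  assumes "rep_iso G \<rho> \<sigma>"
  shows "coeff_span {\<rho>} \<subseteq> coeff_span {\<sigma>}"
proof (rule coeff_span_subset)
  fix \<tau> m a b assume \<tau>: "\<tau> \<in> {\<rho>}" "representation G m \<tau>" "a < m" "b < m"
  obtain n P Q where *: "representation G n \<rho>" "representation G n \<sigma>" "P \<in> carrier_mat n n"
    "Q \<in> carrier_mat n n" "\<And>g. g \<in> carrier G \<Longrightarrow> \<rho> g = Q * \<sigma> g * P"
    using assms by (rule rep_isoE) blast
  have mn: "m = n" using \<tau> *(1) rep_dim_unique by blast
  have "(\<lambda>g. \<Sum>l<n. \<Sum>k<n. (Q $$ (a, k) * P $$ (l, b)) * \<sigma> g $$ (k, l)) \<in> coeff_span {\<sigma>}"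
  proof (intro coeff_span_sum)
    fix l k assume "l \<in> {..<n}" "k \<in> {..<n}"
    hence "(\<lambda>g. \<sigma> g $$ (k, l)) \<in> coeff_span {\<sigma>}" using *(2) by (intro coeff_span.entry[of \<sigma> _ n k l]) auto
    then show "(\<lambda>g. (Q $$ (a, k) * P $$ (l, b)) * \<sigma> g $$ (k, l)) \<in> coeff_span {\<sigma>}"
      by (rule coeff_span.scale[where c = "Q $$ (a, k) * P $$ (l, b)"]) simp
  qed auto
  then show "(\<lambda>g. \<tau> g $$ (a, b)) \<in> coeff_span {\<sigma>}"
  proof (rule coeff_span_cong)
    fix g assume g: "g \<in> carrier G"
    note c = rep_carrier[OF *(2) g] *(3,4)
    have "\<tau> g $$ (a, b) = (\<Sum>l<n. (Q * \<sigma> g) $$ (a, l) * P $$ (l, b))"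
      using \<tau> c mn unfolding singletonD[OF \<tau>(1)] *(5)[OF g] by (intro index_mult_mat_sum) auto
    also have "\<dots> = (\<Sum>l<n. (\<Sum>k<n. Q $$ (a, k) * \<sigma> g $$ (k, l)) * P $$ (l, b))"
    proof (rule sum.cong)
      fix l assume "l \<in> {..<n}"
      then have "(Q * \<sigma> g) $$ (a, l) = (\<Sum>k<n. Q $$ (a, k) * \<sigma> g $$ (k, l))"
        using \<tau> mn c by (intro index_mult_mat_sum) auto
      then show "(Q * \<sigma> g) $$ (a, l) * P $$ (l, b) = (\<Sum>k<n. Q $$ (a, k) * \<sigma> g $$ (k, l)) * P $$ (l, b)"
        by simp
    qed simp
    also have "\<dots> = (\<Sum>l<n. \<Sum>k<n. (Q $$ (a, k) * P $$ (l, b)) * \<sigma> g $$ (k, l))"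
      by (simp add: sum_distrib_right sum_distrib_left mult_ac)
    finally show "\<tau> g $$ (a, b) = (\<Sum>l<n. \<Sum>k<n. (Q $$ (a, k) * P $$ (l, b)) * \<sigma> g $$ (k, l))" .
  qed
qed

text \<open>Each entry of a block diagonal matrix is either zero or an entry of one block.\<close>

lemma coeff_span_direct_sum:
  assumes "\<forall>\<tau>\<in>set \<tau>s. \<exists>n. representation G n \<tau>"
  shows "coeff_span {direct_sum_rep \<tau>s} \<subseteq> coeff_span (set \<tau>s)"
  using assms
proof (induction \<tau>s)
  case Nil
  show ?case
  proof (rule coeff_span_subset)
    fix \<tau> n a b assume \<tau>: "\<tau> \<in> {direct_sum_rep []}" "representation G n \<tau>" "a < n" "b < n"
    have "n = 0" using rep_carrier[OF \<tau>(2) one_closed] \<tau>(1) by (auto simp: direct_sum_rep_Nil)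
    with \<tau> show "(\<lambda>g. \<tau> g $$ (a, b)) \<in> coeff_span (set [])" by simp
  qed
next
  case (Cons \<tau> \<tau>s)
  obtain n m where n: "representation G n \<tau>" and m: "representation G m (direct_sum_rep \<tau>s)"
    using Cons.prems ex_representation_direct_sum[of \<tau>s] by auto
  have sub: "coeff_span {\<tau>} \<subseteq> coeff_span (set (\<tau> # \<tau>s))"
    "coeff_span {direct_sum_rep \<tau>s} \<subseteq> coeff_span (set (\<tau> # \<tau>s))"
    using coeff_span_mono[of "{\<tau>}" "set (\<tau> # \<tau>s)"] coeff_span_mono[of "set \<tau>s" "set (\<tau> # \<tau>s)"] Cons by auto
  show ?case
  proof (rule coeff_span_subset)
    fix \<tau>' k a b assume *: "\<tau>' \<in> {direct_sum_rep (\<tau> # \<tau>s)}" "representation G k \<tau>'" "a < k" "b < k"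
    hence k: "k = n + m" using representation_block_sum[OF n m] rep_dim_unique by (auto simp: direct_sum_rep_Cons)
    have eq: "\<tau>' g $$ (a, b) = (if a < n then if b < n then \<tau> g $$ (a, b) else 0
        else if b < n then 0 else direct_sum_rep \<tau>s g $$ (a - n, b - n))" if g: "g \<in> carrier G" for g
      using * k rep_carrier[OF n g] rep_carrier[OF m g] g n m
      by (auto simp: direct_sum_rep_Cons block_sum_rep_apply)
    consider "a < n" "b < n" | "\<not> a < n" "\<not> b < n" | "(a < n) \<noteq> (b < n)" by blast
    then show "(\<lambda>g. \<tau>' g $$ (a, b)) \<in> coeff_span (set (\<tau> # \<tau>s))"
    proof cases
      case 1
      then have "(\<lambda>g. \<tau>' g $$ (a, b)) \<in> coeff_span {\<tau>}"
        using eq n by (intro coeff_span.entry[of \<tau> _ n a b]) auto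
      then show ?thesis using sub by blast
    next
      case 2
      then have "(\<lambda>g. \<tau>' g $$ (a, b)) \<in> coeff_span {direct_sum_rep \<tau>s}"
        using eq m * k by (intro coeff_span.entry[of "direct_sum_rep \<tau>s" _ m "a - n" "b - n"]) auto
      then show ?thesis using sub by blast
    next
      case 3
      then show ?thesis using eq by (intro coeff_span.zero) auto
    qed
  qed
qed

text \<open>An entry of \<open>\<rho>\<close> times an entry of \<open>\<tau>\<close> is an entry of
  their Kronecker product. Knowledge about the constituents of tensor products thereby becomes a
  statement about multiplying functions. It is applied along the arrows of the quiver and to
  products across the two factors of the group.\<close>

lemma coeff_span_tensor_mult:
  assumes \<rho>: "representation G n \<rho>" and pq: "p < n" "q < n"
    and \<phi>: "\<phi> \<in> coeff_span R"
    and R: "\<And>\<tau>. \<tau> \<in> R \<Longrightarrow> coeff_span {tensor_rep \<rho> \<tau>} \<subseteq> coeff_span R'"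
  shows "(\<lambda>g. \<rho> g $$ (p, q) * \<phi> g) \<in> coeff_span R'"
  using \<phi>
proof induction
  case (entry \<tau> m a b \<phi>)
  have "(\<lambda>g. \<rho> g $$ (p, q) * \<phi> g) \<in> coeff_span {tensor_rep \<rho> \<tau>}"
  proof (rule coeff_span.entry[of "tensor_rep \<rho> \<tau>" _ "n * m" "p * m + a" "q * m + b"])
    show "representation G (n * m) (tensor_rep \<rho> \<tau>)" by (rule representation_tensor[OF \<rho> entry(2)])
    note k = index_kronecker[OF rep_carrier[OF \<rho>] rep_carrier[OF entry(2)] pq entry(3,4)]
    show "p * m + a < n * m" "q * m + b < n * m" using k(1,2)[OF one_closed one_closed] by auto
    show "\<forall>g\<in>carrier G. \<rho> g $$ (p, q) * \<phi> g = tensor_rep \<rho> \<tau> g $$ (p * m + a, q * m + b)"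
      using k(3) entry(5) by (simp add: tensor_rep_def)
  qed simp
  then show ?case using R[OF entry(1)] by blast
next
  case (zero \<phi>)
  then show ?case by (intro coeff_span.zero) auto
next
  case (add \<phi> \<psi> \<theta>)
  show ?case by (rule coeff_span.add[OF add.IH]) (use add in \<open>simp add: algebra_simps\<close>)
next
  case (scale \<phi> \<theta> c)
  show ?case by (rule coeff_span.scale[OF scale.IH, of _ c]) (use scale in \<open>simp add: algebra_simps\<close>)
qed

end

lemma (in finite_group) coeff_span_orthogonal:
  assumes \<phi>: "\<phi> \<in> coeff_span R" and \<tau>: "irreducible_representation G m \<tau>" and cd: "c < m" "d < m"
    and R: "\<And>\<sigma>. \<sigma> \<in> R \<Longrightarrow> \<exists>n. irreducible_representation G n \<sigma>" "\<And>\<sigma>. \<sigma> \<in> R \<Longrightarrow> \<not> rep_iso G \<tau> \<sigma>"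
  shows "(\<Sum>g\<in>carrier G. \<phi> g * \<tau> (inv g) $$ (c, d)) = 0"
  using \<phi>
proof induction
  case (entry \<sigma> n a b \<phi>)
  obtain n' where n': "irreducible_representation G n' \<sigma>" using R(1)[OF entry(1)] by blast
  hence [simp]: "n' = n" using rep_dim_unique irrep_rep entry(2) by blast
  show ?case using matrix_coeffs_orthogonal[OF n' \<tau> R(2)[OF entry(1)], of a b c d] entry cd by simp
next
  case (zero \<phi>)
  then show ?case by simp
next
  case (add \<phi> \<psi> \<theta>)
  then show ?case by (simp add: distrib_right sum.distrib)
next
  case (scale \<phi> \<theta> k)
  then show ?case by (simp add: mult.assoc flip: sum_distrib_left)
qed

section \<open>The McKay matrix through characters, and restriction to the kernel\<close>

context irreps begin

definition "mckay \<rho> = mckay_matrix G \<rho> \<sigma>s"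

lemma with_mults_cong: "(\<And>j. j < r \<Longrightarrow> m j = m' j) \<Longrightarrow> with_mults m = with_mults m'"
  unfolding with_mults_def by (intro arg_cong[where f = concat] map_cong) auto

lemma of_nat_mult_card_cancel:
  "of_nat k * of_nat (card (carrier G)) = (of_nat l * of_nat (card (carrier G)) :: complex) \<longleftrightarrow> k = l"
  using card_carrier_pos by (simp flip: of_nat_mult)

text \<open>Makes the definite description usable: existence comes from complete reducibility,
  uniqueness from reading multiplicities off the character.\<close>

lemma mckay_spec:
  assumes \<rho>: "representation G n \<rho>"
  shows "mckay \<rho> \<in> carrier_mat r r \<and> (\<forall>i<r. rep_iso G (tensor_rep \<rho> (\<sigma>s ! i))
    (direct_sum_rep (with_mults (\<lambda>j. mckay \<rho> $$ (i, j)))))"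
proof -
  let ?spec = "\<lambda>A. A \<in> carrier_mat r r \<and> (\<forall>i<r. rep_iso G (tensor_rep \<rho> (\<sigma>s ! i))
    (direct_sum_rep (with_mults (\<lambda>j. A $$ (i, j)))))"
  have "\<exists>m. rep_iso G (tensor_rep \<rho> (\<sigma>s ! i)) (direct_sum_rep (with_mults m))" if i: "i < r" for i
  proof -
    obtain k where "representation G k (\<sigma>s ! i)" using irrep[OF i] irrep_rep by blast
    then show ?thesis using decomposition[OF representation_tensor[OF \<rho>]] by blast
  qed
  then obtain m where m: "\<And>i. i < r \<Longrightarrow> rep_iso G (tensor_rep \<rho> (\<sigma>s ! i)) (direct_sum_rep (with_mults (m i)))"
    by metis
  have ex: "?spec (mat r r (\<lambda>(i, j). m i j))"
  proof (intro conjI allI impI)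
    fix i assume i: "i < r"
    have "with_mults (\<lambda>j. mat r r (\<lambda>(i, j). m i j) $$ (i, j)) = with_mults (m i)"
      by (rule with_mults_cong) (use i in simp)
    then show "rep_iso G (tensor_rep \<rho> (\<sigma>s ! i))
        (direct_sum_rep (with_mults (\<lambda>j. mat r r (\<lambda>(i, j). m i j) $$ (i, j))))"
      using m[OF i] by simp
  qed simp
  have unique: "A = A'" if A: "?spec A" and A': "?spec A'" for A A'
  proof (rule eq_matI)
    fix i j assume "i < dim_row A'" "j < dim_col A'"
    hence ij: "i < r" "j < r" using A' by auto
    have "of_nat (A $$ (i, j)) * of_nat (card (carrier G)) = (of_nat (A' $$ (i, j)) * of_nat (card (carrier G)) :: complex)"
      using cinner_with_mults[of "tensor_rep \<rho> (\<sigma>s ! i)" "\<lambda>j. A $$ (i, j)" j]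
        cinner_with_mults[of "tensor_rep \<rho> (\<sigma>s ! i)" "\<lambda>j. A' $$ (i, j)" j] A A' ij by metis
    then show "A $$ (i, j) = A' $$ (i, j)" by (simp only: of_nat_mult_card_cancel)
  qed (use A A' in auto)
  have "mckay \<rho> = (THE A. ?spec A)" unfolding mckay_def mckay_matrix_def with_mults_def by simp
  moreover have "?spec (THE A. ?spec A)"
    by (rule theI[of ?spec, OF ex]) (rule unique[OF _ ex])
  ultimately show ?thesis by simp
qed

lemma mckay_entry:
  assumes \<rho>: "representation G n \<rho>" and ij: "i < r" "j < r"
  shows "of_nat (mckay \<rho> $$ (i, j)) * of_nat (card (carrier G)) =
    cinner (\<lambda>g. character \<rho> g * \<chi> i g) (\<chi> j)"
proof -
  obtain k where k: "representation G k (\<sigma>s ! i)" using irrep[OF ij(1)] irrep_rep by blast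
  have "cinner (character (tensor_rep \<rho> (\<sigma>s ! i))) (\<chi> j) = of_nat (mckay \<rho> $$ (i, j)) * of_nat (card (carrier G))"
    by (rule cinner_with_mults) (use mckay_spec[OF \<rho>] ij in auto)
  moreover have "cinner (character (tensor_rep \<rho> (\<sigma>s ! i))) (\<chi> j) = cinner (\<lambda>g. character \<rho> g * \<chi> i g) (\<chi> j)"
    unfolding cinner_def by (intro sum.cong) (simp_all add: character_tensor[OF \<rho> k] \<chi>_def)
  ultimately show ?thesis by simp
qed

text \<open>A substitute for the Burnside--Brauer theorem that needs no eigenvalues: the functions whose
  product with a coefficient of \<open>\<sigma>\<^sub>i\<close> stays in the span of the coefficients of the reachable
  irreducibles contain all products of linear polynomials in the entries of \<open>\<rho>\<close>, hence a
  nonzero multiple of the indicator function of \<open>ker \<rho>\<close>.\<close>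

lemma kernel_orthogonal:
  assumes \<rho>: "representation G n \<rho>" and S: "S \<subseteq> {..<r}"
    and closed: "\<And>i j. i \<in> S \<Longrightarrow> j < r \<Longrightarrow> mckay \<rho> $$ (i, j) \<noteq> 0 \<Longrightarrow> j \<in> S"
    and i: "i \<in> S" and j: "j < r" "j \<notin> S"
    and irr: "irreducible_representation G k (\<sigma>s ! i)" "irreducible_representation G m (\<sigma>s ! j)"
    and ab: "a < k" "b < k" and cd: "c < m" "d < m"
  shows "(\<Sum>g\<in>kernel G (GL n) \<rho>. (\<sigma>s ! i) g $$ (a, b) * (\<sigma>s ! j) (inv g) $$ (c, d)) = 0"
proof -
  let ?R = "(!) \<sigma>s ` S" and ?N = "kernel G (GL n) \<rho>"
  have N: "?N = {g \<in> carrier G. \<rho> g = 1\<^sub>m n}" by (simp add: kernel_def)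
  \<comment> \<open>The constituents of \<open>\<rho>\<close> tensored with the irreducible at
    \<open>l\<close> are the heads of the arrows leaving \<open>l\<close>, and \<open>S\<close> is
    closed under these.\<close>
  have tensor: "coeff_span {tensor_rep \<rho> \<tau>} \<subseteq> coeff_span ?R" if \<tau>: "\<tau> \<in> ?R" for \<tau>
  proof -
    obtain l where l: "l \<in> S" "\<tau> = \<sigma>s ! l" using \<tau> by blast
    let ?m = "\<lambda>j. mckay \<rho> $$ (l, j)"
    have "coeff_span {tensor_rep \<rho> \<tau>} \<subseteq> coeff_span {direct_sum_rep (with_mults ?m)}"
      using mckay_spec[OF \<rho>] l S by (intro coeff_span_iso) auto
    also have "\<dots> \<subseteq> coeff_span (set (with_mults ?m))"
      using set_with_mults_subset set_irreps_rep by (intro coeff_span_direct_sum) blast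
    also have "\<dots> \<subseteq> coeff_span ?R"
      using closed[OF l(1)] by (intro coeff_span_mono) (auto simp: set_with_mults)
    finally show ?thesis .
  qed
  have "\<exists>p q. p < n \<and> q < n \<and> \<rho> x $$ (p, q) \<noteq> 1\<^sub>m n $$ (p, q)" if "x \<in> carrier G - ?N" for x
  proof (rule ccontr)
    assume "\<not> ?thesis"
    hence "\<rho> x = 1\<^sub>m n" using that rep_carrier[OF \<rho>, of x] by (intro eq_matI) auto
    then show False using that by (simp add: N)
  qed
  then obtain p q where pq: "\<And>x. x \<in> carrier G - ?N \<Longrightarrow> p x < n \<and> q x < n \<and>
      \<rho> x $$ (p x, q x) \<noteq> 1\<^sub>m n $$ (p x, q x)" by metis
  \<comment> \<open>The position \<open>(p x, q x)\<close> is one where \<open>\<rho> x\<close>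
    differs from the identity matrix. The factor belonging to \<open>x\<close> is zero at
    \<open>g = x\<close> and a nonzero constant on the kernel, so the product over all
    \<open>x\<close> outside the kernel is a nonzero multiple \<open>C\<close> of its indicator
    function.\<close>
  define L where "L = (\<lambda>X g. \<Prod>x\<in>X. \<rho> g $$ (p x, q x) - \<rho> x $$ (p x, q x))"
  let ?\<phi> = "\<lambda>g. (\<sigma>s ! i) g $$ (a, b)"
  have "(\<lambda>g. L X g * ?\<phi> g) \<in> coeff_span ?R" if "X \<subseteq> carrier G - ?N" for X
  proof -
    have "finite X" using that finite_carrier by (meson finite_Diff finite_subset)
    then show ?thesis using that
    proof (induction X rule: finite_induct)
      case empty
      have "?\<phi> \<in> coeff_span ?R"
        using i irrep_rep[OF irr(1)] ab by (intro coeff_span.entry[of "\<sigma>s ! i" _ k a b]) auto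
      then show ?case by (rule coeff_span_cong) (simp add: L_def)
    next
      case (insert x X)
      hence x: "p x < n" "q x < n" and IH: "(\<lambda>g. L X g * ?\<phi> g) \<in> coeff_span ?R" using pq by auto
      have 1: "(\<lambda>g. \<rho> g $$ (p x, q x) * (L X g * ?\<phi> g)) \<in> coeff_span ?R"
        by (rule coeff_span_tensor_mult[OF \<rho> x IH tensor])
      have 2: "(\<lambda>g. - \<rho> x $$ (p x, q x) * (L X g * ?\<phi> g)) \<in> coeff_span ?R"
        by (rule coeff_span.scale[OF IH, of _ "- \<rho> x $$ (p x, q x)"]) simp
      show ?case by (rule coeff_span.add[OF 1 2]) (use insert in \<open>simp add: L_def algebra_simps\<close>)
    qed
  qed
  from this[OF subset_refl]
  have "(\<Sum>g\<in>carrier G. L (carrier G - ?N) g * ?\<phi> g * (\<sigma>s ! j) (inv g) $$ (c, d)) = 0"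
  proof (rule coeff_span_orthogonal[OF _ irr(2) cd])
    fix \<sigma> assume "\<sigma> \<in> ?R"
    then show "\<exists>n. irreducible_representation G n \<sigma>" "\<not> rep_iso G (\<sigma>s ! j) \<sigma>"
      using S irrep not_iso j by blast+
  qed
  moreover have "L (carrier G - ?N) g = 0" if "g \<in> carrier G - ?N" for g
    using that finite_carrier by (auto simp: L_def)
  ultimately have "(\<Sum>g\<in>?N. L (carrier G - ?N) g * ?\<phi> g * (\<sigma>s ! j) (inv g) $$ (c, d)) = 0"
    using finite_carrier by (subst (asm) sum.mono_neutral_right[of _ ?N]) (auto simp: N)
  moreover define C where "C = (\<Prod>x\<in>carrier G - ?N. 1\<^sub>m n $$ (p x, q x) - \<rho> x $$ (p x, q x))"
  have "L (carrier G - ?N) g = C" if "g \<in> ?N" for g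
    using that by (simp add: L_def C_def N)
  ultimately have "C * (\<Sum>g\<in>?N. ?\<phi> g * (\<sigma>s ! j) (inv g) $$ (c, d)) = 0"
    by (simp add: sum_distrib_left mult.assoc)
  moreover have "C \<noteq> 0" using pq finite_carrier by (force simp: C_def)
  ultimately show ?thesis by simp
qed

end

section \<open>Strong components of a product quiver\<close>

text \<open>The shape of \<open>mckay_quiver\<close> for an arbitrary matrix, which frees the graph
  argument from representation theory.\<close>

definition matrix_quiver :: "nat \<Rightarrow> nat mat \<Rightarrow> (nat, nat \<times> nat \<times> nat) pre_digraph" where
  "matrix_quiver r A = \<lparr> verts = {..<r},
     arcs = {(i, j, k). i < r \<and> j < r \<and> k < A $$ (i, j)},
     tail = (\<lambda>(i, j, k). i), head = (\<lambda>(i, j, k). j) \<rparr>"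

lemma matrix_quiver_simps [simp]:
  "verts (matrix_quiver r A) = {..<r}"
  "arcs (matrix_quiver r A) = {(i, j, k). i < r \<and> j < r \<and> k < A $$ (i, j)}"
  "tail (matrix_quiver r A) = (\<lambda>(i, j, k). i)"
  "head (matrix_quiver r A) = (\<lambda>(i, j, k). j)"
  by (simp_all add: matrix_quiver_def)

lemma wf_matrix_quiver: "wf_digraph (matrix_quiver r A)"
  by unfold_locales auto

lemma dominates_matrix_quiver:
  "u \<rightarrow>\<^bsub>matrix_quiver r A\<^esub> v \<longleftrightarrow> u < r \<and> v < r \<and> A $$ (u, v) \<noteq> 0"
  by (auto simp: arcs_ends_def arc_to_ends_def image_iff)

text \<open>\<open>P\<close> labels the copies, \<open>Q\<close> the vertices inside a copy, and
  \<open>B\<close> is their common adjacency matrix. Connectedness of a copy is phrased through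
  arrow-closed sets \<open>S\<close>: this is what the orthogonality argument delivers, and the set
  of vertices reachable from a given one is an instance.\<close>

locale product_quiver =
  fixes r :: nat and A :: "nat mat" and P Q :: "nat set" and f :: "nat \<Rightarrow> nat \<Rightarrow> nat"
    and B :: "nat \<Rightarrow> nat \<Rightarrow> nat"
  assumes f_bound: "p \<in> P \<Longrightarrow> q \<in> Q \<Longrightarrow> f p q < r"
    and f_surj: "i < r \<Longrightarrow> \<exists>p\<in>P. \<exists>q\<in>Q. i = f p q"
    and f_inj: "p \<in> P \<Longrightarrow> p' \<in> P \<Longrightarrow> q \<in> Q \<Longrightarrow> q' \<in> Q \<Longrightarrow> f p q = f p' q' \<Longrightarrow> p = p' \<and> q = q'"
    and entry: "p \<in> P \<Longrightarrow> p' \<in> P \<Longrightarrow> q \<in> Q \<Longrightarrow> q' \<in> Q \<Longrightarrow>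
      A $$ (f p q, f p' q') = (if p = p' then B q q' else 0)"
    and fibre_connected: "p \<in> P \<Longrightarrow> q \<in> Q \<Longrightarrow> q' \<in> Q \<Longrightarrow> S \<subseteq> {..<r} \<Longrightarrow>
      (\<And>i j. i \<in> S \<Longrightarrow> j < r \<Longrightarrow> A $$ (i, j) \<noteq> 0 \<Longrightarrow> j \<in> S) \<Longrightarrow> f p q \<in> S \<Longrightarrow> f p q' \<in> S"
begin

abbreviation "\<Gamma> \<equiv> matrix_quiver r A"

sublocale wf_digraph \<Gamma> by (rule wf_matrix_quiver)

lemma reachable_fibre:
  assumes "p \<in> P" "q \<in> Q" "q' \<in> Q"
  shows "f p q \<rightarrow>\<^sup>*\<^bsub>\<Gamma>\<^esub> f p q'"
proof -
  let ?S = "{j. f p q \<rightarrow>\<^sup>*\<^bsub>\<Gamma>\<^esub> j}"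
  have "f p q' \<in> ?S"
  proof (rule fibre_connected[OF assms])
    show "?S \<subseteq> {..<r}" using reachable_in_verts(2) by fastforce
    show "f p q \<in> ?S" using f_bound assms by simp
    fix i j assume i: "i \<in> ?S" and j: "j < r" "A $$ (i, j) \<noteq> 0"
    have "i < r" using i reachable_in_verts(2) by fastforce
    hence "i \<rightarrow>\<^bsub>\<Gamma>\<^esub> j" using j by (simp add: dominates_matrix_quiver)
    then show "j \<in> ?S" using i reachable_adj_trans by blast
  qed
  then show ?thesis by simp
qed

lemma reachable_imp_same_fibre:
  assumes "f p q \<rightarrow>\<^sup>*\<^bsub>\<Gamma>\<^esub> v" "p \<in> P" "q \<in> Q"
  shows "v \<in> f p ` Q"
  using assms(1)
proof (induction rule: reachable_induct)
  case base
  then show ?case using assms by blast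
next
  case (step x y)
  then obtain q1 where q1: "q1 \<in> Q" "x = f p q1" by blast
  have y: "y < r" "A $$ (x, y) \<noteq> 0" using step(2) by (auto simp: dominates_matrix_quiver)
  then obtain p2 q2 where 2: "p2 \<in> P" "q2 \<in> Q" "y = f p2 q2" using f_surj by blast
  then show ?case using entry[OF assms(2) 2(1) q1(1) 2(2)] y q1 by (auto split: if_splits)
qed

text \<open>Paths never leave a copy and join any two of its vertices, so the classes of mutual
  reachability are exactly the copies.\<close>

lemma verts_scc:
  assumes "C \<in> sccs"
  obtains p where "p \<in> P" "verts C = f p ` Q"
proof -
  have "verts C \<in> sccs_verts" using assms by (intro in_sccs_vertsI_sccs) blast
  hence C: "verts C \<noteq> {}" "\<And>u v. u \<in> verts C \<Longrightarrow> v \<in> verts C \<Longrightarrow> u \<rightarrow>\<^sup>*\<^bsub>\<Gamma>\<^esub> v"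
    "\<And>u v. u \<in> verts C \<Longrightarrow> v \<notin> verts C \<Longrightarrow> \<not> u \<rightarrow>\<^sup>*\<^bsub>\<Gamma>\<^esub> v \<or> \<not> v \<rightarrow>\<^sup>*\<^bsub>\<Gamma>\<^esub> u"
    unfolding in_sccs_verts_conv_reachable by blast+
  obtain u where u: "u \<in> verts C" using C(1) by blast
  have "u < r" using reachable_in_verts(1)[OF C(2)[OF u u]] by simp
  then obtain p q where pq: "p \<in> P" "q \<in> Q" "u = f p q" using f_surj by blast
  have "verts C = f p ` Q"
  proof
    show "verts C \<subseteq> f p ` Q" using C(2)[OF u] reachable_imp_same_fibre pq by blast
    show "f p ` Q \<subseteq> verts C" using C(3)[OF u] reachable_fibre[OF pq(1)] pq by blast
  qed
  with pq that show thesis by blast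
qed

lemma sccs_isomorphic:
  assumes C: "C \<in> sccs" and D: "D \<in> sccs"
  shows "digraph_iso C D"
proof -
  obtain p where p: "p \<in> P" "verts C = f p ` Q" using verts_scc[OF C] .
  obtain p' where p': "p' \<in> P" "verts D = f p' ` Q" using verts_scc[OF D] .
  \<comment> \<open>Components are induced subgraphs: their vertices determine their arcs, and they
    inherit the head and tail maps of the whole quiver.\<close>
  have induced: "arcs X = {e \<in> arcs \<Gamma>. tail \<Gamma> e \<in> verts X \<and> head \<Gamma> e \<in> verts X}"
      "tail X = tail \<Gamma>" "head X = head \<Gamma>" "wf_digraph X" if "X \<in> sccs" for X
    using in_sccs_imp_induced[OF that]
    unfolding induced_subgraph_def subgraph_def compatible_def by auto
  have arcs: "arcs X = {(f p q, f p q', k) |q q' k. q \<in> Q \<and> q' \<in> Q \<and> k < B q q'}"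
    if "X \<in> sccs" "p \<in> P" "verts X = f p ` Q" for X p
  proof -
    have "arcs X = {(i, j, k). i \<in> f p ` Q \<and> j \<in> f p ` Q \<and> k < A $$ (i, j)}"
      unfolding induced(1)[OF that(1)] that(3) using f_bound that(2) by auto
    also have "\<dots> = {(f p q, f p q', k) |q q' k. q \<in> Q \<and> q' \<in> Q \<and> k < A $$ (f p q, f p q')}" by blast
    also have "\<dots> = {(f p q, f p q', k) |q q' k. q \<in> Q \<and> q' \<in> Q \<and> k < B q q'}"
      by (intro Collect_cong iff_exI conj_cong refl) (simp add: entry that(2))
    finally show ?thesis .
  qed
  \<comment> \<open>The vertex map replaces the label \<open>p\<close> by \<open>p'\<close> and
    keeps the label from \<open>Q\<close>.\<close>
  define h where "h = (\<lambda>i. f p' (the_inv_into Q (f p) i))"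
  have inj: "inj_on (f p) Q" using f_inj[OF p(1) p(1)] by (auto intro: inj_onI)
  have h: "h (f p q) = f p' q" if "q \<in> Q" for q
    unfolding h_def using the_inv_into_f_f[OF inj that] by simp
  have inj': "inj_on h (f p ` Q)"
  proof (rule inj_onI)
    fix x y assume "x \<in> f p ` Q" "y \<in> f p ` Q" "h x = h y"
    then obtain q q' where q: "q \<in> Q" "q' \<in> Q" "x = f p q" "y = f p q'" by blast
    with \<open>h x = h y\<close> have "f p' q = f p' q'" by (simp add: h)
    with f_inj[OF p'(1) p'(1) q(1,2)] q show "x = y" by simp
  qed
  \<comment> \<open>Parallel arrows keep their number \<open>k\<close>, as both copies have the
    multiplicities \<open>B\<close>. The new head and tail maps are again the projections, so that
    the image of \<open>C\<close> equals \<open>D\<close> as a record and not just on its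
    arcs.\<close>
  define \<phi> where "\<phi> = \<lparr> iso_verts = h, iso_arcs = (\<lambda>(i, j, k). (h i, h j, k :: nat)),
    iso_head = (\<lambda>(i, j, k). j), iso_tail = (\<lambda>(i, j, k). i) \<rparr>"
  have "pre_digraph.digraph_isomorphism C \<phi>"
    unfolding pre_digraph.digraph_isomorphism_def
  proof (intro conjI ballI)
    show "wf_digraph C" using induced(4)[OF C] .
    show "inj_on (iso_verts \<phi>) (verts C)" using inj' p by (simp add: \<phi>_def)
    show "inj_on (iso_arcs \<phi>) (arcs C)"
    proof (rule inj_onI)
      fix x y assume xy: "x \<in> arcs C" "y \<in> arcs C" "iso_arcs \<phi> x = iso_arcs \<phi> y"
      have V: "\<exists>i j k. e = (i, j, k) \<and> i \<in> f p ` Q \<and> j \<in> f p ` Q" if "e \<in> arcs C" for e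
        using that unfolding arcs[OF C p] by blast
      obtain i j k where x: "x = (i, j, k)" "i \<in> f p ` Q" "j \<in> f p ` Q" using V[OF xy(1)] by blast
      obtain i' j' k' where y: "y = (i', j', k')" "i' \<in> f p ` Q" "j' \<in> f p ` Q" using V[OF xy(2)] by blast
      have "h i = h i'" "h j = h j'" "k = k'" using xy(3) by (simp_all add: \<phi>_def x y)
      then show "x = y" using inj_onD[OF inj'] x y by simp
    qed
    fix e assume "e \<in> arcs C"
    show "iso_verts \<phi> (tail C e) = iso_tail \<phi> (iso_arcs \<phi> e)" "iso_verts \<phi> (head C e) = iso_head \<phi> (iso_arcs \<phi> e)"
      unfolding induced(2,3)[OF C] by (simp_all add: \<phi>_def split: prod.splits)
  qed
  moreover have "D = app_iso \<phi> C"
  proof (rule pre_digraph.equality)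
    show "verts D = verts (app_iso \<phi> C)"
      unfolding verts_app_iso p p' by (auto simp: \<phi>_def h image_iff)
    show "arcs D = arcs (app_iso \<phi> C)"
      unfolding arcs_app_iso arcs[OF C p] arcs[OF D p']
    proof -
      have map: "iso_arcs \<phi> (f p q, f p q', k) = (f p' q, f p' q', k)" if "q \<in> Q" "q' \<in> Q" for q q' k
        using that by (simp add: \<phi>_def h)
      show "{(f p' q, f p' q', k) |q q' k. q \<in> Q \<and> q' \<in> Q \<and> k < B q q'} =
          iso_arcs \<phi> ` {(f p q, f p q', k) |q q' k. q \<in> Q \<and> q' \<in> Q \<and> k < B q q'}"
      proof (intro equalityI subsetI)
        fix e assume "e \<in> {(f p' q, f p' q', k) |q q' k. q \<in> Q \<and> q' \<in> Q \<and> k < B q q'}"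
        then obtain q q' k where e: "e = (f p' q, f p' q', k)" "q \<in> Q" "q' \<in> Q" "k < B q q'" by blast
        show "e \<in> iso_arcs \<phi> ` {(f p q, f p q', k) |q q' k. q \<in> Q \<and> q' \<in> Q \<and> k < B q q'}"
        proof (rule image_eqI)
          show "e = iso_arcs \<phi> (f p q, f p q', k)" by (simp add: e(1) map[OF e(2,3)])
          show "(f p q, f p q', k) \<in> {(f p q, f p q', k) |q q' k. q \<in> Q \<and> q' \<in> Q \<and> k < B q q'}"
            using e by blast
        qed
      next
        fix e assume "e \<in> iso_arcs \<phi> ` {(f p q, f p q', k) |q q' k. q \<in> Q \<and> q' \<in> Q \<and> k < B q q'}"
        then obtain q q' k where e: "e = iso_arcs \<phi> (f p q, f p q', k)" "q \<in> Q" "q' \<in> Q" "k < B q q'"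
          by blast
        then show "e \<in> {(f p' q, f p' q', k) |q q' k. q \<in> Q \<and> q' \<in> Q \<and> k < B q q'}"
          unfolding e(1) map[OF e(2,3)] by blast
      qed
    qed
  qed (auto simp: induced(2,3)[OF D] \<phi>_def)
  ultimately show ?thesis unfolding digraph_iso_def by blast
qed

end

section \<open>Irreducible representations of an internal direct product\<close>

locale direct_factors = finite_group +
  fixes N H :: "'a set"
  assumes idp: "internal_direct_product G N H"
begin

lemma normal_factors: "N \<lhd> G" "H \<lhd> G" and trivial_inter: "N \<inter> H = {\<one>}" and set_mult_factors: "N <#> H = carrier G"
  using idp by (simp_all add: internal_direct_product_def)

lemma subgroups: "subgroup N G" "subgroup H G"
  using normal_factors by (simp_all add: normal_imp_subgroup)

lemmas factor1_closed [simp] = subgroup.mem_carrier[OF subgroups(1)] subgroup.one_closed[OF subgroups(1)]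
    subgroup.m_closed[OF subgroups(1)] subgroup.m_inv_closed[OF subgroups(1)]
  and factor2_closed [simp] = subgroup.mem_carrier[OF subgroups(2)] subgroup.one_closed[OF subgroups(2)]
    subgroup.m_closed[OF subgroups(2)] subgroup.m_inv_closed[OF subgroups(2)]

text \<open>The commutator of \<open>x\<close> and \<open>y\<close> lies in both normal subgroups,
  hence in their trivial intersection.\<close>

lemma factors_commute:
  assumes x: "x \<in> N" and y: "y \<in> H"
  shows "x \<otimes> y = y \<otimes> x"
proof -
  have "x \<otimes> (y \<otimes> inv x \<otimes> inv y) \<in> N"
    using normal.inv_op_closed2[OF normal_factors(1), of y "inv x"] x y by simp
  moreover have "x \<otimes> y \<otimes> inv x \<otimes> inv y \<in> H"
    using normal.inv_op_closed2[OF normal_factors(2), of x y] x y by simp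
  ultimately have "(x \<otimes> y) \<otimes> inv (y \<otimes> x) = \<one>"
    using trivial_inter x y by (auto simp: m_assoc inv_mult_group)
  then have "inv (inv (y \<otimes> x)) = x \<otimes> y" using x y by (intro inv_equality) auto
  then show ?thesis using x y by simp
qed

lemma factor_mult:
  assumes "x \<in> N" "x' \<in> N" "y \<in> H" "y' \<in> H"
  shows "(x \<otimes> y) \<otimes> (x' \<otimes> y') = (x \<otimes> x') \<otimes> (y \<otimes> y')"
proof -
  have "(x \<otimes> y) \<otimes> (x' \<otimes> y') = x \<otimes> (y \<otimes> x') \<otimes> y'" using assms by (simp add: m_assoc)
  also have "y \<otimes> x' = x' \<otimes> y" using factors_commute[OF assms(2,3)] ..
  also have "x \<otimes> (x' \<otimes> y) \<otimes> y' = (x \<otimes> x') \<otimes> (y \<otimes> y')" using assms by (simp add: m_assoc)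
  finally show ?thesis .
qed

lemma factor_inv:
  assumes "x \<in> N" "y \<in> H"
  shows "inv (x \<otimes> y) = inv x \<otimes> inv y"
  using assms factors_commute[of "inv x" "inv y"] by (simp add: inv_mult_group)

lemma factor_inj:
  assumes "x \<in> N" "x' \<in> N" "y \<in> H" "y' \<in> H" "x \<otimes> y = x' \<otimes> y'"
  shows "x = x' \<and> y = y'"
proof -
  have eq: "inv x' \<otimes> x = y' \<otimes> inv y"
  proof -
    have "x = x \<otimes> y \<otimes> inv y" using assms(1,3) by (simp add: m_assoc)
    also have "\<dots> = x' \<otimes> (y' \<otimes> inv y)" using assms(2-4) by (simp add: assms(5) m_assoc)
    finally have "inv x' \<otimes> x = inv x' \<otimes> (x' \<otimes> (y' \<otimes> inv y))" by simp
    also have "\<dots> = y' \<otimes> inv y" using assms(2-4) by (simp flip: m_assoc)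
    finally show ?thesis .
  qed
  moreover have "inv x' \<otimes> x \<in> N" "y' \<otimes> inv y \<in> H"
    using assms by simp_all
  ultimately have one: "inv x' \<otimes> x = \<one>" "y' \<otimes> inv y = \<one>" using trivial_inter by auto
  have "inv x = inv x'" using assms(1,2) by (intro inv_equality[OF one(1)]) simp_all
  hence "inv (inv x) = inv (inv x')" by simp
  moreover have "inv (inv y) = y'" using assms(3,4) by (intro inv_equality[OF one(2)]) simp_all
  ultimately show ?thesis using assms(1-4) by simp
qed

lemma factor_ex: "g \<in> carrier G \<Longrightarrow> \<exists>x\<in>N. \<exists>y\<in>H. g = x \<otimes> y"
  using set_mult_factors unfolding set_mult_def by blast

definition proj1 :: "'a \<Rightarrow> 'a" where "proj1 g = (SOME x. x \<in> N \<and> (\<exists>y\<in>H. g = x \<otimes> y))"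
definition proj2 :: "'a \<Rightarrow> 'a" where "proj2 g = (SOME y. y \<in> H \<and> (\<exists>x\<in>N. g = x \<otimes> y))"

lemma proj [simp]:
  assumes "x \<in> N" "y \<in> H"
  shows "proj1 (x \<otimes> y) = x" "proj2 (x \<otimes> y) = y"
  unfolding proj1_def proj2_def using assms factor_inj by (blast intro: some_equality)+

lemma bij_factors: "bij_betw (\<lambda>(x, y). x \<otimes> y) (N \<times> H) (carrier G)"
  unfolding bij_betw_def
proof
  show "inj_on (\<lambda>(x, y). x \<otimes> y) (N \<times> H)" using factor_inj by (auto intro!: inj_onI)
  show "(\<lambda>(x, y). x \<otimes> y) ` (N \<times> H) = carrier G" using factor_ex by force
qed

lemma sum_factors: "(\<Sum>g\<in>carrier G. F g) = (\<Sum>x\<in>N. \<Sum>y\<in>H. F (x \<otimes> y))"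
proof -
  have "(\<Sum>g\<in>carrier G. F g) = (\<Sum>z\<in>N \<times> H. F (case z of (x, y) \<Rightarrow> x \<otimes> y))"
    by (rule sum.reindex_bij_betw[OF bij_factors, symmetric])
  also have "\<dots> = (\<Sum>x\<in>N. \<Sum>y\<in>H. F (x \<otimes> y))" by (simp add: sum.cartesian_product case_prod_beta)
  finally show ?thesis .
qed

text \<open>Summing \<open>u\<close> alone over the group counts every element of \<open>N\<close>
  once for each element of \<open>H\<close>, and symmetrically for \<open>v\<close>. The resulting
  surplus is \<open>card N * card H\<close>, the order of the group.\<close>

lemma sum_factors_mult:
  fixes u v :: "'a \<Rightarrow> complex"
  assumes u: "\<And>x y. x \<in> N \<Longrightarrow> y \<in> H \<Longrightarrow> u (x \<otimes> y) = u x"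
    and v: "\<And>x y. x \<in> N \<Longrightarrow> y \<in> H \<Longrightarrow> v (x \<otimes> y) = v y"
  shows "of_nat (card (carrier G)) * (\<Sum>g\<in>carrier G. u g * v g) = (\<Sum>g\<in>carrier G. u g) * (\<Sum>g\<in>carrier G. v g)"
proof -
  have card: "card (carrier G) = card N * card H"
    using bij_betw_same_card[OF bij_factors] by (simp add: card_cartesian_product)
  have "(\<Sum>g\<in>carrier G. u g * v g) = (\<Sum>x\<in>N. \<Sum>y\<in>H. u x * v y)"
    unfolding sum_factors by (intro sum.cong) (simp_all add: u v)
  hence 1: "(\<Sum>g\<in>carrier G. u g * v g) = (\<Sum>x\<in>N. u x) * (\<Sum>y\<in>H. v y)" by (simp add: sum_product)
  have "(\<Sum>g\<in>carrier G. u g) = (\<Sum>x\<in>N. \<Sum>y\<in>H. u x)"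
    unfolding sum_factors by (intro sum.cong) (simp_all add: u)
  hence 2: "(\<Sum>g\<in>carrier G. u g) = of_nat (card H) * (\<Sum>x\<in>N. u x)" by (simp add: sum_distrib_left)
  have "(\<Sum>g\<in>carrier G. v g) = (\<Sum>x\<in>N. \<Sum>y\<in>H. v y)"
    unfolding sum_factors by (intro sum.cong) (simp_all add: v)
  hence 3: "(\<Sum>g\<in>carrier G. v g) = of_nat (card N) * (\<Sum>y\<in>H. v y)" by simp
  show ?thesis unfolding 1 2 3 card by simp
qed

text \<open>Behind both the orthonormality of products of irreducible characters and the computation
  of the McKay matrix on them.\<close>

lemma cinner_factors_mult:
  assumes u: "\<And>x y. x \<in> N \<Longrightarrow> y \<in> H \<Longrightarrow> u (x \<otimes> y) = u x" "\<And>x y. x \<in> N \<Longrightarrow> y \<in> H \<Longrightarrow> u' (x \<otimes> y) = u' x"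
    and v: "\<And>x y. x \<in> N \<Longrightarrow> y \<in> H \<Longrightarrow> v (x \<otimes> y) = v y" "\<And>x y. x \<in> N \<Longrightarrow> y \<in> H \<Longrightarrow> v' (x \<otimes> y) = v' y"
  shows "of_nat (card (carrier G)) * cinner (\<lambda>g. u g * v g) (\<lambda>g. u' g * v' g) = cinner u u' * cinner v v'"
proof -
  have "of_nat (card (carrier G)) * (\<Sum>g\<in>carrier G. (u g * u' (inv g)) * (v g * v' (inv g))) =
      (\<Sum>g\<in>carrier G. u g * u' (inv g)) * (\<Sum>g\<in>carrier G. v g * v' (inv g))"
    by (rule sum_factors_mult) (simp_all add: u v factor_inv)
  then show ?thesis unfolding cinner_def by (simp add: mult_ac)
qed

text \<open>Restriction to one factor, inflated back along the projection: in this way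
  representations of the factors are handled as representations of the whole group.\<close>

lemma proj_rep:
  assumes \<sigma>: "representation G n \<sigma>"
  shows "representation G n (\<lambda>g. \<sigma> (proj1 g))" "representation G n (\<lambda>g. \<sigma> (proj2 g))"
proof -
  have *: "\<sigma> (proj1 g) \<in> carrier_mat n n \<and> \<sigma> (proj2 g) \<in> carrier_mat n n" if "g \<in> carrier G" for g
    using factor_ex[OF that] rep_carrier[OF \<sigma>] by auto
  have one: "proj1 \<one> = \<one>" "proj2 \<one> = \<one>"
    using proj[of \<one> \<one>] by simp_all
  have mult: "\<sigma> (proj1 (g \<otimes> h)) = \<sigma> (proj1 g) * \<sigma> (proj1 h) \<and> \<sigma> (proj2 (g \<otimes> h)) = \<sigma> (proj2 g) * \<sigma> (proj2 h)"
    if gh: "g \<in> carrier G" "h \<in> carrier G" for g h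
  proof -
    obtain x y where "x \<in> N" "y \<in> H" "g = x \<otimes> y" using factor_ex[OF gh(1)] by blast
    moreover obtain x' y' where "x' \<in> N" "y' \<in> H" "h = x' \<otimes> y'" using factor_ex[OF gh(2)] by blast
    ultimately show ?thesis by (simp add: factor_mult rep_mult[OF \<sigma>])
  qed
  show "representation G n (\<lambda>g. \<sigma> (proj1 g))" "representation G n (\<lambda>g. \<sigma> (proj2 g))"
    using * mult one rep_one[OF \<sigma>] by (auto intro!: representationI)
qed

end

text \<open>The size of the identity matrix is taken from the value itself, so no dimension has to
  be carried along.\<close>

definition trivial_on :: "'g set \<Rightarrow> ('g \<Rightarrow> complex mat) \<Rightarrow> bool" where
  "trivial_on K \<rho> \<longleftrightarrow> (\<forall>k\<in>K. \<rho> k = 1\<^sub>m (dim_row (\<rho> k)))"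

context group begin

lemma trivial_on_iso:
  assumes "rep_iso G \<rho> \<sigma>" "K \<subseteq> carrier G" "trivial_on K \<rho>"
  shows "trivial_on K \<sigma>"
  unfolding trivial_on_def
proof
  obtain n P Q where *: "representation G n \<rho>" "representation G n \<sigma>" "P \<in> carrier_mat n n"
    "Q \<in> carrier_mat n n" "P * Q = 1\<^sub>m n" "\<And>g. g \<in> carrier G \<Longrightarrow> P * \<rho> g = \<sigma> g * P"
    using assms(1) by (rule rep_isoE) blast
  fix k assume k: "k \<in> K"
  hence kG: "k \<in> carrier G" using assms(2) by blast
  have "\<rho> k = 1\<^sub>m n" using assms(3) k rep_carrier[OF *(1) kG] by (auto simp: trivial_on_def)
  hence "\<sigma> k * P = P" using *(6)[OF kG] *(3) by simp
  moreover have "\<sigma> k * P * Q = \<sigma> k * (P * Q)"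
    using rep_carrier[OF *(2) kG] *(3,4) by (intro assoc_mult_mat) auto
  ultimately have "\<sigma> k = 1\<^sub>m n" using *(5) rep_carrier[OF *(2) kG] by simp
  then show "\<sigma> k = 1\<^sub>m (dim_row (\<sigma> k))" by simp
qed

lemma trivial_on_direct_sum:
  assumes "trivial_on K (direct_sum_rep \<tau>s)" "\<forall>\<tau>\<in>set \<tau>s. \<exists>n. representation G n \<tau>" "K \<subseteq> carrier G"
  shows "\<forall>\<tau>\<in>set \<tau>s. trivial_on K \<tau>"
  using assms
proof (induction \<tau>s)
  case (Cons \<tau> \<tau>s)
  obtain n m where n: "representation G n \<tau>" and m: "representation G m (direct_sum_rep \<tau>s)"
    using Cons.prems ex_representation_direct_sum[of \<tau>s] by auto
  have *: "\<tau> k = 1\<^sub>m n \<and> direct_sum_rep \<tau>s k = 1\<^sub>m m" if k: "k \<in> K" for k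
  proof -
    have kG: "k \<in> carrier G" using k Cons.prems(3) by blast
    note c = rep_carrier[OF n kG] rep_carrier[OF m kG]
    have "direct_sum_rep (\<tau> # \<tau>s) k = 1\<^sub>m (n + m)"
      using Cons.prems(1) k rep_carrier[OF representation_block_sum[OF n m] kG]
      unfolding trivial_on_def direct_sum_rep_Cons by auto
    then have e: "four_block_mat (\<tau> k) (0\<^sub>m n m) (0\<^sub>m m n) (direct_sum_rep \<tau>s k) =
        four_block_mat (1\<^sub>m n) (0\<^sub>m n m) (0\<^sub>m m n) (1\<^sub>m m)"
      by (simp add: direct_sum_rep_Cons block_sum_rep_apply[OF n m kG])
    show ?thesis
      by (intro conjI four_block_mat_inj(1)[OF _ _ _ _ _ _ _ _ e] four_block_mat_inj(3)[OF _ _ _ _ _ _ _ _ e])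
        (use c in auto)
  qed
  then show ?case using Cons by (auto simp: trivial_on_def)
qed simp

end

section \<open>Irreducibles of the direct product as tensor products\<close>

locale split_irreps = irreps + direct_factors
begin

text \<open>The letter names the factor that may act nontrivially: \<open>IN\<close> stands for the
  irreducibles of \<open>N\<close>, inflated to the group, and therefore requires triviality on
  \<open>H\<close>; \<open>IH\<close> is the mirror image.\<close>

definition "IN = {p. p < r \<and> trivial_on H (\<sigma>s ! p)}"
definition "IH = {q. q < r \<and> trivial_on N (\<sigma>s ! q)}"

lemma trivial_on_mult:
  assumes \<sigma>: "representation G n \<sigma>" and x: "x \<in> N" and y: "y \<in> H"
  shows "trivial_on H \<sigma> \<Longrightarrow> \<sigma> (x \<otimes> y) = \<sigma> x" "trivial_on N \<sigma> \<Longrightarrow> \<sigma> (x \<otimes> y) = \<sigma> y"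
  using rep_carrier[OF \<sigma>, of x] rep_carrier[OF \<sigma>, of y] x y
  by (auto simp: trivial_on_def rep_mult[OF \<sigma>])

lemma \<chi>_IN: "p \<in> IN \<Longrightarrow> x \<in> N \<Longrightarrow> y \<in> H \<Longrightarrow> \<chi> p (x \<otimes> y) = \<chi> p x"
  and \<chi>_IH: "q \<in> IH \<Longrightarrow> x \<in> N \<Longrightarrow> y \<in> H \<Longrightarrow> \<chi> q (x \<otimes> y) = \<chi> q y"
  using irrep irrep_rep trivial_on_mult unfolding \<chi>_def character_def IN_def IH_def by (metis mem_Collect_eq)+

lemma cinner_products:
  assumes "p \<in> IN" "p' \<in> IN" "q \<in> IH" "q' \<in> IH"
  shows "cinner (\<lambda>g. \<chi> p g * \<chi> q g) (\<lambda>g. \<chi> p' g * \<chi> q' g) =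
    (if p = p' \<and> q = q' then of_nat (card (carrier G)) else 0)"
proof -
  have "of_nat (card (carrier G)) * cinner (\<lambda>g. \<chi> p g * \<chi> q g) (\<lambda>g. \<chi> p' g * \<chi> q' g) =
      cinner (\<chi> p) (\<chi> p') * cinner (\<chi> q) (\<chi> q')"
    using assms by (intro cinner_factors_mult) (simp_all add: \<chi>_IN \<chi>_IH)
  then show ?thesis using assms card_carrier_pos by (auto simp: cinner_\<chi> IN_def IH_def split: if_splits)
qed

text \<open>The pairing of the product character with itself is the group order, so the squares of
  the multiplicities sum to 1 and a single irreducible occurs, once. Only its character and its
  coefficient span are recorded, the two consequences needed below.\<close>

lemma tensor_irreducible:
  assumes p: "p \<in> IN" and q: "q \<in> IH"
  shows "\<exists>k<r. (\<forall>g\<in>carrier G. \<chi> k g = \<chi> p g * \<chi> q g) \<and>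
    coeff_span {tensor_rep (\<sigma>s ! p) (\<sigma>s ! q)} \<subseteq> coeff_span {\<sigma>s ! k}"
proof -
  obtain n m where n: "representation G n (\<sigma>s ! p)" and m: "representation G m (\<sigma>s ! q)"
    using irrep irrep_rep p q unfolding IN_def IH_def by blast
  let ?\<tau> = "tensor_rep (\<sigma>s ! p) (\<sigma>s ! q)" and ?c = "of_nat (card (carrier G)) :: complex"
  obtain \<mu> where \<mu>: "rep_iso G ?\<tau> (direct_sum_rep (with_mults \<mu>))"
    using decomposition[OF representation_tensor[OF n m]] .
  have char: "character ?\<tau> g = \<chi> p g * \<chi> q g" if "g \<in> carrier G" for g
    using character_tensor[OF n m that] by (simp add: \<chi>_def)
  have "?c = cinner (character ?\<tau>) (character ?\<tau>)"
    using cinner_products[OF p p q q] unfolding cinner_def by (simp add: char)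
  also have "\<dots> = (\<Sum>g\<in>carrier G. \<Sum>j<r. of_nat (\<mu> j) * (character ?\<tau> g * \<chi> j (inv g)))"
    unfolding cinner_def by (intro sum.cong) (simp_all add: character_with_mults[OF \<mu> inv_closed] sum_distrib_left mult_ac)
  also have "\<dots> = (\<Sum>j<r. of_nat (\<mu> j) * cinner (character ?\<tau>) (\<chi> j))"
    by (subst sum.swap) (simp add: cinner_def sum_distrib_left)
  also have "\<dots> = (\<Sum>j<r. of_nat (\<mu> j) * (of_nat (\<mu> j) * ?c))"
    by (intro sum.cong) (simp_all add: cinner_with_mults[OF \<mu>])
  also have "\<dots> = of_nat (\<Sum>j<r. \<mu> j * \<mu> j) * ?c" by (simp add: sum_distrib_left mult_ac)
  finally have "of_nat 1 * ?c = of_nat (\<Sum>j<r. \<mu> j * \<mu> j) * ?c" by simp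
  hence "(\<Sum>j<r. \<mu> j * \<mu> j) = 1" unfolding of_nat_mult_card_cancel by simp
  then obtain k where k: "k < r" "\<mu> k * \<mu> k = 1" "\<forall>j<r. j \<noteq> k \<longrightarrow> \<mu> j * \<mu> j = 0"
    by (subst (asm) sum_eq_1_iff) auto
  hence \<mu>k: "\<mu> j = (if j = k then 1 else 0)" if "j < r" for j using that by auto
  have "\<chi> k g = \<chi> p g * \<chi> q g" if "g \<in> carrier G" for g
  proof -
    have "\<chi> p g * \<chi> q g = (\<Sum>j<r. of_nat (\<mu> j) * \<chi> j g)"
      using char[OF that] character_with_mults[OF \<mu> that] by simp
    also have "\<dots> = (\<Sum>j<r. if j = k then \<chi> j g else 0)" by (intro sum.cong) (simp_all add: \<mu>k)
    finally show ?thesis using k by simp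
  qed
  moreover have "coeff_span {?\<tau>} \<subseteq> coeff_span {\<sigma>s ! k}"
  proof -
    have "coeff_span {?\<tau>} \<subseteq> coeff_span {direct_sum_rep (with_mults \<mu>)}" by (rule coeff_span_iso[OF \<mu>])
    also have "\<dots> \<subseteq> coeff_span (set (with_mults \<mu>))"
      using set_with_mults_subset set_irreps_rep by (intro coeff_span_direct_sum) blast
    also have "\<dots> \<subseteq> coeff_span {\<sigma>s ! k}"
      using \<mu>k by (intro coeff_span_mono) (auto simp: set_with_mults split: if_splits)
    finally show ?thesis .
  qed
  ultimately show ?thesis using k by blast
qed

definition prod_index :: "nat \<Rightarrow> nat \<Rightarrow> nat" where
  "prod_index p q = (SOME k. k < r \<and> (\<forall>g\<in>carrier G. \<chi> k g = \<chi> p g * \<chi> q g) \<and>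
    coeff_span {tensor_rep (\<sigma>s ! p) (\<sigma>s ! q)} \<subseteq> coeff_span {\<sigma>s ! k})"

lemma prod_index:
  assumes "p \<in> IN" "q \<in> IH"
  shows "prod_index p q < r" "g \<in> carrier G \<Longrightarrow> \<chi> (prod_index p q) g = \<chi> p g * \<chi> q g"
    "coeff_span {tensor_rep (\<sigma>s ! p) (\<sigma>s ! q)} \<subseteq> coeff_span {\<sigma>s ! prod_index p q}"
  using someI_ex[OF tensor_irreducible[OF assms]] unfolding prod_index_def by blast+

text \<open>Constituents of a representation trivial on a subgroup are trivial on it too, so an
  inflated restriction decomposes within \<open>IN\<close> or within \<open>IH\<close>.\<close>

lemma coeff_span_proj:
  assumes \<sigma>: "representation G n \<sigma>"
  shows "coeff_span {\<lambda>g. \<sigma> (proj1 g)} \<subseteq> coeff_span ((!) \<sigma>s ` IN)"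
    "coeff_span {\<lambda>g. \<sigma> (proj2 g)} \<subseteq> coeff_span ((!) \<sigma>s ` IH)"
proof -
  have *: "coeff_span {\<tau>} \<subseteq> coeff_span ((!) \<sigma>s ` {i. i < r \<and> trivial_on K (\<sigma>s ! i)})"
    if \<tau>: "representation G n \<tau>" and K: "K \<subseteq> carrier G" "trivial_on K \<tau>" for \<tau> K
  proof -
    obtain \<mu> where \<mu>: "rep_iso G \<tau> (direct_sum_rep (with_mults \<mu>))" using decomposition[OF \<tau>] .
    have reps: "\<forall>\<tau>\<in>set (with_mults \<mu>). \<exists>n. representation G n \<tau>"
      using set_with_mults_subset set_irreps_rep by blast
    have "\<forall>\<tau>\<in>set (with_mults \<mu>). trivial_on K \<tau>"
      using trivial_on_direct_sum[OF trivial_on_iso[OF \<mu> K] reps K(1)] .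
    hence "set (with_mults \<mu>) \<subseteq> (!) \<sigma>s ` {i. i < r \<and> trivial_on K (\<sigma>s ! i)}"
      by (auto simp: set_with_mults)
    then show ?thesis
      using coeff_span_iso[OF \<mu>] coeff_span_direct_sum[OF reps] coeff_span_mono by blast
  qed
  have "proj1 y = \<one>" if "y \<in> H" for y using proj(1)[OF _ that, of \<one>] that by simp
  hence "trivial_on H (\<lambda>g. \<sigma> (proj1 g))" by (simp add: trivial_on_def rep_one[OF \<sigma>])
  then show "coeff_span {\<lambda>g. \<sigma> (proj1 g)} \<subseteq> coeff_span ((!) \<sigma>s ` IN)"
    unfolding IN_def by (intro * proj_rep[OF \<sigma>]) auto
  have "proj2 x = \<one>" if "x \<in> N" for x using proj(2)[OF that, of \<one>] that by simp
  hence "trivial_on N (\<lambda>g. \<sigma> (proj2 g))" by (simp add: trivial_on_def rep_one[OF \<sigma>])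
  then show "coeff_span {\<lambda>g. \<sigma> (proj2 g)} \<subseteq> coeff_span ((!) \<sigma>s ` IH)"
    unfolding IH_def by (intro * proj_rep[OF \<sigma>]) auto
qed

text \<open>Since \<open>\<sigma>(g) = \<sigma>(\<pi>\<^sub>1 g) \<sigma>(\<pi>\<^sub>2 g)\<close>, the coefficients of any \<open>\<sigma>\<close> are combinations of products of
  coefficients of representations trivial on \<open>H\<close> and on \<open>N\<close>.\<close>

lemma prod_index_surj:
  assumes i: "i < r"
  shows "\<exists>p\<in>IN. \<exists>q\<in>IH. i = prod_index p q"
proof (rule ccontr)
  assume neg: "\<not> ?thesis"
  obtain n where irr: "irreducible_representation G n (\<sigma>s ! i)" using irrep[OF i] by blast
  define \<sigma> where "\<sigma> = \<sigma>s ! i"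
  have \<sigma>: "representation G n \<sigma>" using irr irrep_rep by (simp add: \<sigma>_def)
  have n0: "0 < n" using irr by (simp add: irreducible_representation_def)
  let ?J = "{prod_index p q |p q. p \<in> IN \<and> q \<in> IH}"
  let ?R = "(!) \<sigma>s ` ?J"
  \<comment> \<open>Bilinearity in two stages: the induction here treats the first function, and
    \<open>coeff_span_tensor_mult\<close> the second one.\<close>
  have prod: "(\<lambda>g. \<phi> g * \<psi> g) \<in> coeff_span ?R"
    if \<phi>: "\<phi> \<in> coeff_span ((!) \<sigma>s ` IN)" and \<psi>: "\<psi> \<in> coeff_span ((!) \<sigma>s ` IH)" for \<phi> \<psi>
    using \<phi>
  proof induction
    case (entry \<tau> m a b \<phi>)
    then obtain p where p: "p \<in> IN" "\<tau> = \<sigma>s ! p" by blast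
    have "(\<lambda>g. \<tau> g $$ (a, b) * \<psi> g) \<in> coeff_span ?R"
    proof (rule coeff_span_tensor_mult[OF entry(2-4) \<psi>])
      fix \<tau>' assume "\<tau>' \<in> (!) \<sigma>s ` IH"
      then obtain q where q: "q \<in> IH" "\<tau>' = \<sigma>s ! q" by blast
      have "coeff_span {\<sigma>s ! prod_index p q} \<subseteq> coeff_span ?R" using p q by (intro coeff_span_mono) blast
      then show "coeff_span {tensor_rep \<tau> \<tau>'} \<subseteq> coeff_span ?R" using prod_index(3)[OF p(1) q(1)] p q by blast
    qed
    then show ?case by (rule coeff_span_cong) (use entry in simp)
  next
    case (zero \<phi>)
    then show ?case by (intro coeff_span.zero) auto
  next
    case (add \<phi> \<phi>' \<theta>)
    show ?case by (rule coeff_span.add[OF add.IH]) (use add in \<open>simp add: algebra_simps\<close>)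
  next
    case (scale \<phi> \<theta> c)
    show ?case by (rule coeff_span.scale[OF scale.IH, of _ c]) (use scale in \<open>simp add: algebra_simps\<close>)
  qed
  have "(\<lambda>g. \<sigma> g $$ (0, b)) \<in> coeff_span ?R" if b: "b < n" for b
  proof -
    have "(\<lambda>g. \<Sum>c<n. \<sigma> (proj1 g) $$ (0, c) * \<sigma> (proj2 g) $$ (c, b)) \<in> coeff_span ?R"
    proof (intro coeff_span_sum prod)
      fix c assume "c \<in> {..<n}"
      hence c: "c < n" by simp
      have "(\<lambda>g. \<sigma> (proj1 g) $$ (0, c)) \<in> coeff_span {\<lambda>g. \<sigma> (proj1 g)}"
        by (rule coeff_span.entry[OF _ proj_rep(1)[OF \<sigma>] n0 c]) auto
      then show "(\<lambda>g. \<sigma> (proj1 g) $$ (0, c)) \<in> coeff_span ((!) \<sigma>s ` IN)" using coeff_span_proj[OF \<sigma>] by blast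
      have "(\<lambda>g. \<sigma> (proj2 g) $$ (c, b)) \<in> coeff_span {\<lambda>g. \<sigma> (proj2 g)}"
        by (rule coeff_span.entry[OF _ proj_rep(2)[OF \<sigma>] c b]) auto
      then show "(\<lambda>g. \<sigma> (proj2 g) $$ (c, b)) \<in> coeff_span ((!) \<sigma>s ` IH)" using coeff_span_proj[OF \<sigma>] by blast
    qed simp
    then show ?thesis
    proof (rule coeff_span_cong)
      fix g assume "g \<in> carrier G"
      then obtain x y where xy: "x \<in> N" "y \<in> H" "g = x \<otimes> y" using factor_ex by blast
      have "\<sigma> g $$ (0, b) = (\<sigma> x * \<sigma> y) $$ (0, b)" using xy by (simp add: rep_mult[OF \<sigma>])
      also have "\<dots> = (\<Sum>c<n. \<sigma> x $$ (0, c) * \<sigma> y $$ (c, b))"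
        using xy n0 b by (intro index_mult_mat_sum[OF rep_carrier[OF \<sigma>] rep_carrier[OF \<sigma>]]) auto
      finally show "\<sigma> g $$ (0, b) = (\<Sum>c<n. \<sigma> (proj1 g) $$ (0, c) * \<sigma> (proj2 g) $$ (c, b))"
        using xy by simp
    qed
  qed
  \<comment> \<open>The first row of \<open>\<sigma>\<close> lies in a span to which
    \<open>\<sigma>\<close>, not being a product, is orthogonal. Summed over \<open>b\<close>, the
    products form the entry \<open>(0, 0)\<close> of \<open>\<sigma> g * \<sigma> (inv g)\<close>,
    which is 1 for every \<open>g\<close>; the total would be both the group order and zero.\<close>
  hence zero: "(\<Sum>g\<in>carrier G. \<sigma> g $$ (0, b) * \<sigma> (inv g) $$ (b, 0)) = 0" if "b < n" for b
    unfolding \<sigma>_def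
  proof (rule coeff_span_orthogonal[OF _ irr that n0])
    show "b < n" by (rule that)
    fix \<tau> assume "\<tau> \<in> ?R"
    then obtain p q where pq: "p \<in> IN" "q \<in> IH" "\<tau> = \<sigma>s ! prod_index p q" by blast
    show "\<exists>n. irreducible_representation G n \<tau>" using irrep prod_index(1) pq by blast
    show "\<not> rep_iso G (\<sigma>s ! i) \<tau>" using not_iso[OF i prod_index(1)[OF pq(1,2)]] neg pq by blast
  qed
  have "of_nat (card (carrier G)) = (\<Sum>g\<in>carrier G. \<Sum>b<n. \<sigma> g $$ (0, b) * \<sigma> (inv g) $$ (b, 0))"
  proof -
    have "(\<Sum>b<n. \<sigma> g $$ (0, b) * \<sigma> (inv g) $$ (b, 0)) = 1" if g: "g \<in> carrier G" for g
    proof -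
      have "(\<sigma> g * \<sigma> (inv g)) $$ (0, 0) = (\<Sum>b<n. \<sigma> g $$ (0, b) * \<sigma> (inv g) $$ (b, 0))"
        using g n0 by (intro index_mult_mat_sum[OF rep_carrier[OF \<sigma>] rep_carrier[OF \<sigma>]]) auto
      then show ?thesis using rep_inv(1)[OF \<sigma> g] n0 by simp
    qed
    then show ?thesis by simp
  qed
  also have "\<dots> = 0" by (subst sum.swap) (simp add: zero)
  finally show False using card_carrier_pos by simp
qed

text \<open>At equal positions the product characters pair to the group order, which
  \<open>cinner_products\<close> allows only for equal pairs.\<close>

lemma prod_index_inj:
  assumes "p \<in> IN" "p' \<in> IN" "q \<in> IH" "q' \<in> IH" "prod_index p q = prod_index p' q'"
  shows "p = p' \<and> q = q'"
proof -
  have "cinner (\<lambda>g. \<chi> p g * \<chi> q g) (\<lambda>g. \<chi> p' g * \<chi> q' g) = cinner (\<chi> (prod_index p q)) (\<chi> (prod_index p' q'))"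
    unfolding cinner_def using assms(1-4) by (intro sum.cong) (simp_all add: prod_index(2))
  also have "\<dots> = of_nat (card (carrier G))"
    using assms(5) cinner_\<chi> prod_index(1)[OF assms(2,4)] by simp
  finally show ?thesis using cinner_products[OF assms(1-4)] card_carrier_pos by (auto split: if_splits)
qed

text \<open>The character of \<open>\<rho>\<close> ignores the \<open>N\<close>-component and so can
  be grouped with \<open>\<chi> q\<close>. The pairing that computes the entry then factors into
  that of \<open>\<chi> p\<close> with \<open>\<chi> p'\<close> and the one that computes the entry
  at \<open>(q, q')\<close>.\<close>

lemma mckay_prod_index:
  assumes \<rho>: "representation G n \<rho>" and N: "N = kernel G (GL n) \<rho>"
    and m: "p \<in> IN" "p' \<in> IN" "q \<in> IH" "q' \<in> IH"
  shows "mckay \<rho> $$ (prod_index p q, prod_index p' q') = (if p = p' then mckay \<rho> $$ (q, q') else 0)"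
proof -
  let ?c = "of_nat (card (carrier G)) :: complex"
  have \<rho>_H: "character \<rho> (x \<otimes> y) = character \<rho> y" if x: "x \<in> N" and y: "y \<in> H" for x y
  proof -
    have "\<rho> x = 1\<^sub>m n" using x unfolding N kernel_def by simp
    then have "\<rho> (x \<otimes> y) = \<rho> y"
      using rep_mult[OF \<rho> factor1_closed(1)[OF x] factor2_closed(1)[OF y]]
        rep_carrier[OF \<rho> factor2_closed(1)[OF y]] by simp
    then show ?thesis by (simp add: character_def)
  qed
  have qr: "q < r" "q' < r" "p < r" "p' < r" using m by (simp_all add: IN_def IH_def)
  let ?a = "of_nat (mckay \<rho> $$ (prod_index p q, prod_index p' q')) :: complex"
  have "?a * ?c = cinner (\<lambda>g. \<chi> p g * (character \<rho> g * \<chi> q g)) (\<lambda>g. \<chi> p' g * \<chi> q' g)"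
    unfolding mckay_entry[OF \<rho> prod_index(1)[OF m(1,3)] prod_index(1)[OF m(2,4)]]
    unfolding cinner_def using m by (intro sum.cong) (simp_all add: prod_index(2) mult_ac)
  hence "?c * (?a * ?c) = cinner (\<chi> p) (\<chi> p') * cinner (\<lambda>g. character \<rho> g * \<chi> q g) (\<chi> q')"
    using m by (simp only:) (intro cinner_factors_mult, simp_all add: \<chi>_IN \<chi>_IH \<rho>_H)
  also have "\<dots> = (if p = p' then ?c else 0) * (of_nat (mckay \<rho> $$ (q, q')) * ?c)"
    using qr by (simp add: cinner_\<chi> mckay_entry[OF \<rho>])
  finally have e: "?c * (?a * ?c) = (if p = p' then ?c else 0) * (of_nat (mckay \<rho> $$ (q, q')) * ?c)" .
  have c0: "?c \<noteq> 0" using card_carrier_pos by simp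
  show ?thesis
  proof (cases "p = p'")
    case True
    hence if_c: "(if p = p' then ?c else 0) = ?c" by simp
    have "?a = of_nat (mckay \<rho> $$ (q, q'))"
      using e c0 unfolding if_c mult_cancel_left mult_cancel_right by blast
    hence "mckay \<rho> $$ (prod_index p q, prod_index p' q') = mckay \<rho> $$ (q, q')"
      by (simp only: of_nat_eq_iff)
    then show ?thesis using True by simp
  next
    case False
    with e c0 show ?thesis by simp
  qed
qed

text \<open>On \<open>N\<close> the characters at both positions are multiples of
  \<open>\<chi> p\<close>, by the nonzero degrees of the irreducibles at \<open>q\<close> and
  \<open>q'\<close>. If the second position were outside \<open>S\<close>,
  \<open>kernel_orthogonal\<close> would force the sum of
  \<open>\<chi> p x * \<chi> p (inv x)\<close> over \<open>N\<close> to vanish, but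
  \<open>card H\<close> times this sum is the group order.\<close>

lemma fibre_connected:
  assumes \<rho>: "representation G n \<rho>" and N: "N = kernel G (GL n) \<rho>"
    and m: "p \<in> IN" "q \<in> IH" "q' \<in> IH" and S: "S \<subseteq> {..<r}"
    and closed: "\<And>i j. i \<in> S \<Longrightarrow> j < r \<Longrightarrow> mckay \<rho> $$ (i, j) \<noteq> 0 \<Longrightarrow> j \<in> S"
    and "prod_index p q \<in> S"
  shows "prod_index p q' \<in> S"
proof (rule ccontr)
  assume neg: "prod_index p q' \<notin> S"
  let ?i = "prod_index p q" and ?j = "prod_index p q'"
  have ij: "?i < r" "?j < r" using prod_index(1) m by auto
  obtain k l where irr: "irreducible_representation G k (\<sigma>s ! ?i)" "irreducible_representation G l (\<sigma>s ! ?j)"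
    using irrep ij by blast
  \<comment> \<open>A product of two traces is a double sum over diagonal coefficients, to each of
    which \<open>kernel_orthogonal\<close> applies.\<close>
  have "(\<Sum>g\<in>N. \<chi> ?i g * \<chi> ?j (inv g)) = (\<Sum>g\<in>N. \<Sum>a<k. \<Sum>c<l. (\<sigma>s ! ?i) g $$ (a, a) * (\<sigma>s ! ?j) (inv g) $$ (c, c))"
  proof (rule sum.cong)
    fix g assume "g \<in> N"
    hence "dim_row ((\<sigma>s ! ?i) g) = k" "dim_row ((\<sigma>s ! ?j) (inv g)) = l"
      using rep_carrier[OF irrep_rep[OF irr(1)], of g] rep_carrier[OF irrep_rep[OF irr(2)], of "inv g"] by auto
    then show "\<chi> ?i g * \<chi> ?j (inv g) = (\<Sum>a<k. \<Sum>c<l. (\<sigma>s ! ?i) g $$ (a, a) * (\<sigma>s ! ?j) (inv g) $$ (c, c))"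
      by (simp add: \<chi>_def character_def mat_trace_def sum_product)
  qed simp
  also have "\<dots> = (\<Sum>a<k. \<Sum>g\<in>N. \<Sum>c<l. (\<sigma>s ! ?i) g $$ (a, a) * (\<sigma>s ! ?j) (inv g) $$ (c, c))"
    by (rule sum.swap)
  also have "\<dots> = (\<Sum>a<k. \<Sum>c<l. \<Sum>g\<in>N. (\<sigma>s ! ?i) g $$ (a, a) * (\<sigma>s ! ?j) (inv g) $$ (c, c))"
    by (intro sum.cong sum.swap) auto
  also have "\<dots> = 0"
    using kernel_orthogonal[OF \<rho> S closed assms(8) ij(2) neg irr] by (simp add: N)
  finally have 0: "(\<Sum>g\<in>N. \<chi> ?i g * \<chi> ?j (inv g)) = 0" .
  have const: "\<chi> t x = \<chi> t \<one>" if "t \<in> IH" "x \<in> N" for t x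
    using \<chi>_IH[OF that, of \<one>] that by simp
  have "\<chi> ?i x * \<chi> ?j (inv x) = \<chi> p x * \<chi> p (inv x) * (\<chi> q \<one> * \<chi> q' \<one>)" if x: "x \<in> N" for x
    using x m(1) by (simp add: prod_index(2)[OF m(1,2)] prod_index(2)[OF m(1,3)] const[OF m(2) x]
        const[OF m(3) factor1_closed(4)[OF x]])
  hence "(\<Sum>x\<in>N. \<chi> p x * \<chi> p (inv x)) * (\<chi> q \<one> * \<chi> q' \<one>) = 0"
    using 0 by (simp add: sum_distrib_right)
  moreover have "\<chi> t \<one> \<noteq> 0" if t: "t \<in> IH" for t
  proof -
    have "t < r" using t by (simp add: IH_def)
    then obtain d where d: "irreducible_representation G d (\<sigma>s ! t)" using irrep by blast
    then show ?thesis
      using rep_one[OF irrep_rep[OF d]] by (simp add: \<chi>_def character_def irreducible_representation_def)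
  qed
  ultimately have *: "(\<Sum>x\<in>N. \<chi> p x * \<chi> p (inv x)) = 0" using m by simp
  have "cinner (\<chi> p) (\<chi> p) = (\<Sum>x\<in>N. \<Sum>y\<in>H. \<chi> p x * \<chi> p (inv x))"
    unfolding cinner_def sum_factors
    using m(1) by (intro sum.cong) (simp_all add: factor_inv \<chi>_IN)
  also have "\<dots> = of_nat (card H) * (\<Sum>x\<in>N. \<chi> p x * \<chi> p (inv x))" by (simp add: sum_distrib_left)
  finally show False using * cinner_\<chi> m(1) card_carrier_pos by (simp add: IN_def)
qed

end

theorem proposition4p3:
  fixes G :: "('g, 'm) monoid_scheme"
    and n :: nat
    and \<rho> :: "'g \<Rightarrow> complex mat"
    and \<sigma>s :: "('g \<Rightarrow> complex mat) list"
    and H :: "'g set"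
  assumes "group G" and "finite (carrier G)"
    and "representation G n \<rho>"
    and "complete_irreps G \<sigma>s"
    and "internal_direct_product G (kernel G (GL n) \<rho>) H"
  shows "\<forall>C \<in> pre_digraph.sccs (mckay_quiver G \<rho> \<sigma>s).
           \<forall>D \<in> pre_digraph.sccs (mckay_quiver G \<rho> \<sigma>s). digraph_iso C D"
proof -
  interpret group G by fact
  interpret split_irreps G \<sigma>s "kernel G (GL n) \<rho>" H
    by unfold_locales (fact assms)+
  \<comment> \<open>Copies are labelled by \<open>IN\<close> and their vertices by
    \<open>IH\<close>; the common adjacency matrix is the McKay matrix itself, read at positions
    from \<open>IH\<close>.\<close>
  interpret product_quiver "length \<sigma>s" "mckay \<rho>" IN IH prod_index "\<lambda>q q'. mckay \<rho> $$ (q, q')"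
  proof
    fix i assume "i < length \<sigma>s"
    then show "\<exists>p\<in>IN. \<exists>q\<in>IH. i = prod_index p q" by (rule prod_index_surj)
  next
    fix p q q' S
    assume "p \<in> IN" "q \<in> IH" "q' \<in> IH" "S \<subseteq> {..<length \<sigma>s}"
      "\<And>i j. i \<in> S \<Longrightarrow> j < length \<sigma>s \<Longrightarrow> mckay \<rho> $$ (i, j) \<noteq> 0 \<Longrightarrow> j \<in> S" "prod_index p q \<in> S"
    then show "prod_index p q' \<in> S" by (rule fibre_connected[OF assms(3) refl])
  qed (fact prod_index(1) prod_index_inj mckay_prod_index[OF assms(3) refl])+
  have "mckay_quiver G \<rho> \<sigma>s = matrix_quiver (length \<sigma>s) (mckay \<rho>)"
    by (simp add: mckay_quiver_def matrix_quiver_def mckay_def)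
  then show ?thesis using sccs_isomorphic by simp
qed

end
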